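(* Let $G$ be a group and let $A$ be a subset of $G$ of minimal type. Then any two minimal closed $G$-invariant subsets of $X_A$ are isomorphic as $G$-spaces (i.e., $G$-equivariantly homeomorphic).
   Context: $G$ is a discrete group. A locally compact $G$-space is a locally compact Hausdorff space with an action of $G$ by homeomorphisms. It is minimal if it is non-empty and every orbit is dense; it is co-compact if there is a compact $K\subseteq X$ with $\bigcup_{g\in G}g.K=X$ (minimal locally compact $G$-spaces are co-compact). A minimal closed $G$-invariant subset is a non-empty closed $G$-invariant subset containing no proper non-empty closed $G$-invariant subset. A pointed locally compact $G$-space is a pair $(X,x_0)$ with $x_0\in X$ such that $G.x_0$ is dense in $X$. $\beta G$ is the Stone–Čech compactification of the discrete space $G$, with the $G$-action extending left multiplication. For $B\subseteq G$, $K_B$ is the closure of $B$ in $\beta G$, and for non-empty $A\subseteq G$, $X_A=\bigcup_{g\in G}K_{gA}$, an open $G$-invariant subset of $\beta G$. For non-empty $A,B\subseteq G$ write $A\propto B$ if $A\subseteq FB$ for some finite $F\subseteq G$, and $A\approx B$ if $A\propto B$ and $B\propto A$; $[A]$ is the $\approx$-class of $A$. Type: for a pointed locally compact $G$-space $(X,x_0)$ put $\mathcal M(G,X,x_0)=\{B\subseteq G:\overline{B.x_0}\text{ is compact}\}$, and $\mathcal M_A=\{B\subseteq G: B\subseteq FA\text{ for some finite }F\subseteq G\}$. If $X$ is co-compact, there is a non-empty $A\subseteq G$, unique up to $\approx$, with $\mathcal M(G,X,x_0)=\mathcal M_A$, and $\mathrm{T}(G,X,x_0)=[A]$. A non-empty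 subset $A\subseteq G$ is of minimal type if $\mathrm{T}(G,X,x_0)=[A]$ for some pointed minimal locally compact $G$-space $(X,x_0)$. *)

theory Defs
  imports "HOL-Analysis.Analysis" "HOL-Algebra.Group_Action"
begin

section \<open>Locally compact G-spaces\<close>

text \<open>
  As always with \<^locale>\<open>group_action\<close>, the maps \<open>\<phi> g\<close> are taken to be extensional, i.e. they have
  the value \<open>undefined\<close> outside the space acted upon.  Continuity of every \<open>\<phi> g\<close> is all that
  is needed for an action by homeomorphisms, \<open>\<phi> (inv g)\<close> being the inverse of \<open>\<phi> g\<close>.
\<close>

locale locally_compact_G_space = group_action G "topspace X" \<phi>
  for G (structure) and X :: "'x topology" and \<phi> +
  assumes locally_compact: "locally_compact_space X"
    and Hausdorff: "Hausdorff_space X"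
    and continuous: "g \<in> carrier G \<Longrightarrow> continuous_map X X (\<phi> g)"

definition minimal_G_space ::
  "('g, 'm) monoid_scheme \<Rightarrow> 'x topology \<Rightarrow> ('g \<Rightarrow> 'x \<Rightarrow> 'x) \<Rightarrow> bool" where
  "minimal_G_space G X \<phi> \<longleftrightarrow>
     topspace X \<noteq> {} \<and> (\<forall>x \<in> topspace X. X closure_of orbit G \<phi> x = topspace X)"

definition pointed_locally_compact_G_space ::
  "('g, 'm) monoid_scheme \<Rightarrow> 'x topology \<Rightarrow> ('g \<Rightarrow> 'x \<Rightarrow> 'x) \<Rightarrow> 'x \<Rightarrow> bool" where
  "pointed_locally_compact_G_space G X \<phi> x0 \<longleftrightarrow>
     locally_compact_G_space G X \<phi> \<and>
     x0 \<in> topspace X \<and> X closure_of orbit G \<phi> x0 = topspace X"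

definition G_invariant ::
  "('g, 'm) monoid_scheme \<Rightarrow> ('g \<Rightarrow> 'x \<Rightarrow> 'x) \<Rightarrow> 'x set \<Rightarrow> bool" where
  "G_invariant G \<phi> S \<longleftrightarrow> (\<forall>g \<in> carrier G. \<phi> g ` S \<subseteq> S)"

definition minimal_closed_invariant ::
  "('g, 'm) monoid_scheme \<Rightarrow> 'x topology \<Rightarrow> ('g \<Rightarrow> 'x \<Rightarrow> 'x) \<Rightarrow> 'x set \<Rightarrow> bool" where
  "minimal_closed_invariant G X \<phi> M \<longleftrightarrow>
     closedin X M \<and> G_invariant G \<phi> M \<and> M \<noteq> {} \<and>
     (\<forall>N. closedin X N \<and> G_invariant G \<phi> N \<and> N \<noteq> {} \<longrightarrow> \<not> N \<subset> M)"

text \<open>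
  Only the values of \<open>\<phi>\<close> on \<open>X\<close> and of \<open>\<psi>\<close> on \<open>Y\<close> matter here, so for invariant subspaces
  the action of the ambient space can be used without restricting it.
\<close>

definition isomorphic_G_spaces ::
  "('g, 'm) monoid_scheme \<Rightarrow> 'x topology \<Rightarrow> ('g \<Rightarrow> 'x \<Rightarrow> 'x) \<Rightarrow>
   'y topology \<Rightarrow> ('g \<Rightarrow> 'y \<Rightarrow> 'y) \<Rightarrow> bool" where
  "isomorphic_G_spaces G X \<phi> Y \<psi> \<longleftrightarrow>
     (\<exists>f. homeomorphic_map X Y f \<and>
          (\<forall>g \<in> carrier G. \<forall>x \<in> topspace X. f (\<phi> g x) = \<psi> g (f x)))"


section \<open>Type of a pointed G-space\<close>

definition covered_by_translates ::
  "('g, 'm) monoid_scheme \<Rightarrow> 'g set \<Rightarrow> 'g set \<Rightarrow> bool" where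
  "covered_by_translates G A B \<longleftrightarrow> (\<exists>F \<subseteq> carrier G. finite F \<and> A \<subseteq> F <#>\<^bsub>G\<^esub> B)"

definition translate_class :: "('g, 'm) monoid_scheme \<Rightarrow> 'g set \<Rightarrow> 'g set set" where
  "translate_class G A =
     {B. B \<subseteq> carrier G \<and> B \<noteq> {} \<and>
         covered_by_translates G A B \<and> covered_by_translates G B A}"

definition translate_ideal :: "('g, 'm) monoid_scheme \<Rightarrow> 'g set \<Rightarrow> 'g set set" where
  "translate_ideal G A = {B. B \<subseteq> carrier G \<and> covered_by_translates G B A}"

definition relatively_compact_family ::
  "('g, 'm) monoid_scheme \<Rightarrow> 'x topology \<Rightarrow> ('g \<Rightarrow> 'x \<Rightarrow> 'x) \<Rightarrow> 'x \<Rightarrow> 'g set set" where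
  "relatively_compact_family G X \<phi> x0 =
     {B. B \<subseteq> carrier G \<and> compactin X (X closure_of ((\<lambda>b. \<phi> b x0) ` B))}"

text \<open>
  The type is the equivalence class of any \<open>A\<close> with
  \<open>relatively_compact_family G X \<phi> x0 = translate_ideal G A\<close>.  The set of all such \<open>A\<close> is this
  class (see \<open>G_space_type_eq\<close> below), which avoids a choice of representative.
\<close>

definition G_space_type ::
  "('g, 'm) monoid_scheme \<Rightarrow> 'x topology \<Rightarrow> ('g \<Rightarrow> 'x \<Rightarrow> 'x) \<Rightarrow> 'x \<Rightarrow> 'g set set" where
  "G_space_type G X \<phi> x0 =
     {A. A \<subseteq> carrier G \<and> A \<noteq> {} \<and> relatively_compact_family G X \<phi> x0 = translate_ideal G A}"

lemma covered_by_translates_refl: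
  assumes "group G" "A \<subseteq> carrier G"
  shows "covered_by_translates G A A"
proof -
  interpret group G by fact
  have "A \<subseteq> {\<one>\<^bsub>G\<^esub>} <#>\<^bsub>G\<^esub> A"
    using assms(2) by (force simp: set_mult_def)
  then show ?thesis
    unfolding covered_by_translates_def by (intro exI[of _ "{\<one>\<^bsub>G\<^esub>}"]) auto
qed

lemma covered_by_translates_trans:
  assumes "group G" and C: "C \<subseteq> carrier G"
    and "covered_by_translates G A B" "covered_by_translates G B C"
  shows "covered_by_translates G A C"
proof -
  interpret group G by fact
  obtain E F where E: "E \<subseteq> carrier G" "finite E" "A \<subseteq> E <#>\<^bsub>G\<^esub> B"
    and F: "F \<subseteq> carrier G" "finite F" "B \<subseteq> F <#>\<^bsub>G\<^esub> C"
    using assms(3,4) unfolding covered_by_translates_def by blast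
  have "A \<subseteq> E <#>\<^bsub>G\<^esub> (F <#>\<^bsub>G\<^esub> C)"
    using E(3) F(3) mono_set_mult[of E E B "F <#>\<^bsub>G\<^esub> C" G] by blast
  also have "\<dots> = (E <#>\<^bsub>G\<^esub> F) <#>\<^bsub>G\<^esub> C"
    using E(1) F(1) C by (simp add: set_mult_assoc)
  finally have "A \<subseteq> (E <#>\<^bsub>G\<^esub> F) <#>\<^bsub>G\<^esub> C" .
  moreover have "finite (E <#>\<^bsub>G\<^esub> F)"
    using E(2) F(2) by (auto simp: set_mult_def)
  moreover have "E <#>\<^bsub>G\<^esub> F \<subseteq> carrier G"
    using E(1) F(1) by (rule set_mult_closed)
  ultimately show ?thesis
    unfolding covered_by_translates_def by blast
qed

lemma G_space_type_eq:
  assumes G: "group G" and A: "A \<subseteq> carrier G" "A \<noteq> {}"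
    and eq: "relatively_compact_family G X \<phi> x0 = translate_ideal G A"
  shows "G_space_type G X \<phi> x0 = translate_class G A"
proof -
  have "translate_ideal G A = translate_ideal G B \<longleftrightarrow>
          covered_by_translates G A B \<and> covered_by_translates G B A"
    if B: "B \<subseteq> carrier G" for B
  proof
    assume "translate_ideal G A = translate_ideal G B"
    then show "covered_by_translates G A B \<and> covered_by_translates G B A"
      using covered_by_translates_refl[OF G] A(1) B
      unfolding translate_ideal_def by blast
  next
    assume "covered_by_translates G A B \<and> covered_by_translates G B A"
    then show "translate_ideal G A = translate_ideal G B"
      using covered_by_translates_trans[OF G] A(1) B
      unfolding translate_ideal_def by blast
  qed
  then show ?thesis
    unfolding G_space_type_def translate_class_def eq by blast
qed

text \<open>
  HOL has no quantification over types inside formulas, so the type \<open>'x\<close> of the points of the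
  space witnessing minimal type is a parameter.  In a theorem with hypothesis
  \<open>minimal_type TYPE('x) G A\<close> the variable \<open>'x\<close> is universally quantified, which amounts to the
  hypothesis that there is a witnessing space of some type.
\<close>

definition minimal_type :: "'x itself \<Rightarrow> ('g, 'm) monoid_scheme \<Rightarrow> 'g set \<Rightarrow> bool" where
  "minimal_type _ G A \<longleftrightarrow>
     A \<subseteq> carrier G \<and> A \<noteq> {} \<and>
     (\<exists>(X :: 'x topology) \<phi> x0.
        pointed_locally_compact_G_space G X \<phi> x0 \<and> minimal_G_space G X \<phi> \<and>
        G_space_type G X \<phi> x0 = translate_class G A)"


section \<open>The Stone--Cech compactification of a discrete group\<close>

text \<open>
  The Stone--Cech compactification of a discrete set \<open>S\<close> is realised by the ultrafilters on \<open>S\<close>,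
  with the topology generated by the sets of all ultrafilters containing a given \<open>B \<subseteq> S\<close>; a point
  \<open>s\<close> corresponds to the principal ultrafilter \<open>principal {s}\<close>.  The characteristic properties
  are established below: the space is compact Hausdorff, it contains the discrete space \<open>S\<close>
  as a dense subspace, and every map from \<open>S\<close> to a compact Hausdorff space extends continuously.
\<close>

definition ultrafilters_on :: "'a set \<Rightarrow> 'a filter set" where
  "ultrafilters_on S =
     {p. p \<le> principal S \<and> p \<noteq> bot \<and>
         (\<forall>B. eventually (\<lambda>x. x \<in> B) p \<or> eventually (\<lambda>x. x \<notin> B) p)}"

definition Stone_Cech :: "'a set \<Rightarrow> 'a filter topology" where
  "Stone_Cech S =
     topology_generated_by
       ((\<lambda>B. {p \<in> ultrafilters_on S. eventually (\<lambda>x. x \<in> B) p}) ` Pow S)"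

definition Stone_Cech_action :: "('g, 'm) monoid_scheme \<Rightarrow> 'g \<Rightarrow> 'g filter \<Rightarrow> 'g filter" where
  "Stone_Cech_action G g = restrict (filtermap (\<lambda>h. g \<otimes>\<^bsub>G\<^esub> h)) (ultrafilters_on (carrier G))"

definition K_set :: "('g, 'm) monoid_scheme \<Rightarrow> 'g set \<Rightarrow> 'g filter set" where
  "K_set G B = Stone_Cech (carrier G) closure_of ((\<lambda>b. principal {b}) ` B)"

definition X_set :: "('g, 'm) monoid_scheme \<Rightarrow> 'g set \<Rightarrow> 'g filter set" where
  "X_set G A = (\<Union>g \<in> carrier G. K_set G (g <#\<^bsub>G\<^esub> A))"

definition X_space :: "('g, 'm) monoid_scheme \<Rightarrow> 'g set \<Rightarrow> 'g filter topology" where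
  "X_space G A = subtopology (Stone_Cech (carrier G)) (X_set G A)"


subsection \<open>Characteristic properties of the model\<close>

lemma ultrafilters_onD:
  assumes "p \<in> ultrafilters_on S"
  shows "p \<noteq> bot" "eventually (\<lambda>x. x \<in> S) p"
    "\<not> eventually P p \<longleftrightarrow> eventually (\<lambda>x. \<not> P x) p"
proof -
  show 1: "p \<noteq> bot" and "eventually (\<lambda>x. x \<in> S) p"
    using assms by (auto simp: ultrafilters_on_def le_principal)
  have "eventually P p \<or> eventually (\<lambda>x. \<not> P x) p"
    using assms[unfolded ultrafilters_on_def, simplified, THEN conjunct2, THEN conjunct2,
        rule_format, of "Collect P"] by simp
  moreover have "\<not> (eventually P p \<and> eventually (\<lambda>x. \<not> P x) p)"
    using 1 eventually_conj[of P p "\<lambda>x. \<not> P x"] by (auto simp: trivial_limit_def)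
  ultimately show "\<not> eventually P p \<longleftrightarrow> eventually (\<lambda>x. \<not> P x) p" by blast
qed

lemma filtermap_eqI:
  assumes "eventually (\<lambda>x. f x = g x) p"
  shows "filtermap f p = filtermap g p"
proof (rule filter_eq_iff[THEN iffD2], rule allI)
  fix P
  have "eventually (\<lambda>x. P (f x) \<longleftrightarrow> P (g x)) p"
    using assms by (rule eventually_mono) simp
  then show "eventually P (filtermap f p) \<longleftrightarrow> eventually P (filtermap g p)"
    unfolding eventually_filtermap by (rule eventually_subst)
qed

lemma ultrafilter_finite_UN:
  assumes p: "p \<in> ultrafilters_on S" and "finite I"
    and "eventually (\<lambda>x. \<exists>i\<in>I. P i x) p"
  shows "\<exists>i\<in>I. eventually (P i) p"
proof (rule ccontr)
  assume "\<not> ?thesis"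
  then have "\<forall>i\<in>I. eventually (\<lambda>x. \<not> P i x) p"
    using ultrafilters_onD(3)[OF p] by blast
  then have "eventually (\<lambda>x. \<forall>i\<in>I. \<not> P i x) p"
    using \<open>finite I\<close> by (simp add: eventually_ball_finite)
  then have "eventually (\<lambda>x. \<not> (\<exists>i\<in>I. P i x)) p" by simp
  then show False
    using assms(3) ultrafilters_onD(3)[OF p] by blast
qed

lemma openin_Stone_Cech:
  "openin (Stone_Cech S) U \<longleftrightarrow>
     U \<subseteq> ultrafilters_on S \<and>
     (\<forall>p\<in>U. \<exists>B\<subseteq>S. eventually (\<lambda>x. x \<in> B) p \<and>
        {q \<in> ultrafilters_on S. eventually (\<lambda>x. x \<in> B) q} \<subseteq> U)" (is "_ \<longleftrightarrow> ?R U")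
proof
  let ?B = "(\<lambda>B. {p \<in> ultrafilters_on S. eventually (\<lambda>x. x \<in> B) p}) ` Pow S"
  assume "openin (Stone_Cech S) U"
  then have "generate_topology_on ?B U"
    unfolding Stone_Cech_def by (rule openin_topology_generated_by)
  then show "?R U"
  proof induction
    case (Int a b)
    show ?case
    proof (intro conjI ballI)
      fix p assume p: "p \<in> a \<inter> b"
      obtain C D where "C \<subseteq> S" "eventually (\<lambda>x. x \<in> C) p"
        "{q \<in> ultrafilters_on S. eventually (\<lambda>x. x \<in> C) q} \<subseteq> a"
        "D \<subseteq> S" "eventually (\<lambda>x. x \<in> D) p"
        "{q \<in> ultrafilters_on S. eventually (\<lambda>x. x \<in> D) q} \<subseteq> b"
        using Int.IH p by blast
      then show "\<exists>B\<subseteq>S. eventually (\<lambda>x. x \<in> B) p \<and>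
          {q \<in> ultrafilters_on S. eventually (\<lambda>x. x \<in> B) q} \<subseteq> a \<inter> b"
        by (intro exI[of _ "C \<inter> D"]) (auto simp: eventually_conj_iff)
    qed (use Int.IH in blast)
  next
    case (UN K)
    show ?case
    proof (intro conjI ballI)
      fix p assume "p \<in> \<Union>K"
      then obtain k where "k \<in> K" "p \<in> k" by blast
      then show "\<exists>B\<subseteq>S. eventually (\<lambda>x. x \<in> B) p \<and>
          {q \<in> ultrafilters_on S. eventually (\<lambda>x. x \<in> B) q} \<subseteq> \<Union>K"
        using UN.IH[of k] by (meson Union_upper order_trans)
    qed (use UN.IH in blast)
  qed auto
next
  assume R: "?R U"
  have "U = \<Union>{V. V \<subseteq> U \<and> openin (Stone_Cech S) V}"
  proof (intro equalityI subsetI)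
    fix p assume p: "p \<in> U"
    then obtain B where B: "B \<subseteq> S" "eventually (\<lambda>x. x \<in> B) p"
      "{q \<in> ultrafilters_on S. eventually (\<lambda>x. x \<in> B) q} \<subseteq> U"
      using R by blast
    moreover have "openin (Stone_Cech S) {q \<in> ultrafilters_on S. eventually (\<lambda>x. x \<in> B) q}"
      unfolding Stone_Cech_def using B(1) by (intro topology_generated_by_Basis) blast
    ultimately show "p \<in> \<Union>{V. V \<subseteq> U \<and> openin (Stone_Cech S) V}"
      using p R by blast
  qed blast
  moreover have "openin (Stone_Cech S) (\<Union>{V. V \<subseteq> U \<and> openin (Stone_Cech S) V})"
    by blast
  ultimately show "openin (Stone_Cech S) U" by metis
qed

lemma topspace_Stone_Cech [simp]: "topspace (Stone_Cech S) = ultrafilters_on S"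
proof (rule antisym)
  show "topspace (Stone_Cech S) \<subseteq> ultrafilters_on S"
    using openin_topspace[of "Stone_Cech S"] unfolding openin_Stone_Cech by blast
  have "openin (Stone_Cech S) (ultrafilters_on S)"
    unfolding openin_Stone_Cech using ultrafilters_onD(2) by (intro conjI ballI exI[of _ S]) auto
  then show "ultrafilters_on S \<subseteq> topspace (Stone_Cech S)" by (rule openin_subset)
qed

lemma openin_Stone_Cech_basic:
  assumes "B \<subseteq> S"
  shows "openin (Stone_Cech S) {p \<in> ultrafilters_on S. eventually (\<lambda>x. x \<in> B) p}"
  unfolding openin_Stone_Cech using assms by blast

lemma principal_in_ultrafilters_on [simp]: "principal {s} \<in> ultrafilters_on S \<longleftrightarrow> s \<in> S"
  by (auto simp: ultrafilters_on_def eventually_principal le_principal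
      principal_eq_bot_iff)

lemma Hausdorff_Stone_Cech: "Hausdorff_space (Stone_Cech S)"
  unfolding Hausdorff_space_def
proof (intro allI impI)
  fix p q assume "p \<in> topspace (Stone_Cech S) \<and> q \<in> topspace (Stone_Cech S) \<and> p \<noteq> q"
  then have p: "p \<in> ultrafilters_on S" and q: "q \<in> ultrafilters_on S" and "p \<noteq> q" by auto
  then obtain P where P: "eventually P p" "\<not> eventually P q"
    using filter_eq_iff[of p q] ultrafilters_onD(3) by metis
  let ?U = "\<lambda>B. {r \<in> ultrafilters_on S. eventually (\<lambda>x. x \<in> B) r}"
  have "p \<in> ?U (S \<inter> Collect P)" "q \<in> ?U (S - Collect P)"
    using p q P ultrafilters_onD[OF p] ultrafilters_onD[OF q] by (auto simp: eventually_conj_iff)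
  moreover have "disjnt (?U (S \<inter> Collect P)) (?U (S - Collect P))"
    using ultrafilters_onD(3) by (fastforce simp: disjnt_iff eventually_conj_iff)
  ultimately show "\<exists>U V. openin (Stone_Cech S) U \<and> openin (Stone_Cech S) V \<and>
      p \<in> U \<and> q \<in> V \<and> disjnt U V"
    using openin_Stone_Cech_basic[of "S \<inter> Collect P" S]
      openin_Stone_Cech_basic[of "S - Collect P" S] by blast
qed

lemma ex_ultrafilter:
  assumes F: "F \<le> principal S" "F \<noteq> bot"
  shows "\<exists>p \<in> ultrafilters_on S. p \<le> F"
proof -
  define \<A> where "\<A> = {\<E>. (\<forall>P. eventually P F \<longrightarrow> Collect P \<in> \<E>) \<and>
      (\<forall>\<D>. finite \<D> \<longrightarrow> \<D> \<subseteq> \<E> \<longrightarrow> \<Inter>\<D> \<noteq> {})}"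
  have "\<exists>M\<in>\<A>. \<forall>X\<in>\<A>. M \<subseteq> X \<longrightarrow> X = M"
  proof (rule subset_Zorn_nonempty)
    have "\<Inter>\<D> \<noteq> {}" if "finite \<D>" "\<D> \<subseteq> {Collect P |P. eventually P F}" for \<D>
    proof -
      have "\<forall>D\<in>\<D>. eventually (\<lambda>x. x \<in> D) F" using that(2) by auto
      then have "eventually (\<lambda>x. \<forall>D\<in>\<D>. x \<in> D) F"
        using that(1) by (simp add: eventually_ball_finite)
      then have "\<exists>x. \<forall>D\<in>\<D>. x \<in> D" using F(2) eventually_happens by blast
      then show ?thesis by blast
    qed
    then have "{Collect P |P. eventually P F} \<in> \<A>" unfolding \<A>_def by blast
    then show "\<A> \<noteq> {}" by blast
  next
    fix \<C> assume ne: "\<C> \<noteq> {}" and ch: "subset.chain \<A> \<C>"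
    have sub\<A>: "\<C> \<subseteq> \<A>" using ch unfolding subset_chain_def by blast
    have "\<Inter>\<D> \<noteq> {}" if fin: "finite \<D>" and sub: "\<D> \<subseteq> \<Union>\<C>" for \<D>
    proof -
      obtain \<E> where "\<E> \<in> \<C>" "\<D> \<subseteq> \<E>"
        using finite_subset_Union_chain[OF fin sub ne ch] by blast
      moreover have "\<E> \<in> \<A>" using sub\<A> \<open>\<E> \<in> \<C>\<close> by blast
      ultimately show ?thesis using fin unfolding \<A>_def by blast
    qed
    moreover have "Collect P \<in> \<Union>\<C>" if "eventually P F" for P
    proof -
      obtain \<E> where "\<E> \<in> \<C>" using ne by blast
      then have "\<E> \<in> \<A>" using sub\<A> by blast
      then show ?thesis using that \<open>\<E> \<in> \<C>\<close> unfolding \<A>_def by blast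
    qed
    ultimately show "\<Union>\<C> \<in> \<A>" unfolding \<A>_def by blast
  qed
  then obtain M where M: "M \<in> \<A>" and max: "\<And>X. X \<in> \<A> \<Longrightarrow> M \<subseteq> X \<Longrightarrow> X = M" by blast
  have ev: "Collect P \<in> M" if "eventually P F" for P using M that by (simp add: \<A>_def)
  have fip: "\<Inter>\<D> \<noteq> {}" if "finite \<D>" "\<D> \<subseteq> M" for \<D> using M that by (simp add: \<A>_def)
  have ext: "B \<in> M \<longleftrightarrow> (\<forall>\<D>. finite \<D> \<longrightarrow> \<D> \<subseteq> M \<longrightarrow> B \<inter> \<Inter>\<D> \<noteq> {})" for B
  proof
    assume B: "B \<in> M"
    show "\<forall>\<D>. finite \<D> \<longrightarrow> \<D> \<subseteq> M \<longrightarrow> B \<inter> \<Inter>\<D> \<noteq> {}"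
    proof (intro allI impI)
      fix \<D> assume "finite \<D>" "\<D> \<subseteq> M"
      then show "B \<inter> \<Inter>\<D> \<noteq> {}" using fip[of "insert B \<D>"] B by simp
    qed
  next
    assume *: "\<forall>\<D>. finite \<D> \<longrightarrow> \<D> \<subseteq> M \<longrightarrow> B \<inter> \<Inter>\<D> \<noteq> {}"
    have "\<Inter>\<D> \<noteq> {}" if "finite \<D>" "\<D> \<subseteq> insert B M" for \<D>
    proof -
      have "finite (\<D> - {B})" "\<D> - {B} \<subseteq> M" using that by auto
      then have "B \<inter> \<Inter>(\<D> - {B}) \<noteq> {}" using *[THEN spec, of "\<D> - {B}"] by simp
      then show ?thesis by blast
    qed
    then have "insert B M \<in> \<A>" using ev by (simp add: \<A>_def)
    then show "B \<in> M" using max[of "insert B M"] by blast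
  qed
  have Int: "A \<inter> B \<in> M" if "A \<in> M" "B \<in> M" for A B
    unfolding ext[of "A \<inter> B"]
  proof (intro allI impI)
    fix \<D> assume "finite \<D>" "\<D> \<subseteq> M"
    then show "A \<inter> B \<inter> \<Inter>\<D> \<noteq> {}"
      using fip[of "insert A (insert B \<D>)"] that by (simp add: Int_assoc)
  qed
  have mono: "B \<in> M" if "A \<in> M" "A \<subseteq> B" for A B
  proof -
    have "B \<inter> \<Inter>\<D> \<noteq> {}" if "finite \<D>" "\<D> \<subseteq> M" for \<D>
    proof -
      have "A \<inter> \<Inter>\<D> \<noteq> {}" using \<open>A \<in> M\<close>[unfolded ext[of A]] that by blast
      then show ?thesis using \<open>A \<subseteq> B\<close> by blast
    qed
    then show ?thesis using ext[of B] by blast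
  qed
  have dich: "B \<in> M \<or> - B \<in> M" for B
  proof (rule ccontr)
    assume "\<not> ?thesis"
    then have "B \<notin> M" "- B \<notin> M" by blast+
    then obtain \<D> \<E> where DE: "finite \<D>" "\<D> \<subseteq> M" "B \<inter> \<Inter>\<D> = {}"
      "finite \<E>" "\<E> \<subseteq> M" "- B \<inter> \<Inter>\<E> = {}"
      using ext[of B] ext[of "- B"] by metis
    then have "\<Inter>(\<D> \<union> \<E>) \<noteq> {}" by (intro fip) auto
    moreover have "\<Inter>(\<D> \<union> \<E>) = \<Inter>\<D> \<inter> \<Inter>\<E>" by (rule Inter_Un_distrib)
    ultimately show False using DE(3,6) by blast
  qed
  define p where "p = Abs_filter (\<lambda>P. Collect P \<in> M)"
  have p: "eventually P p \<longleftrightarrow> Collect P \<in> M" for P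
    unfolding p_def
  proof (rule eventually_Abs_filter, rule is_filter.intro)
    show "{x. True} \<in> M" using ev[of "\<lambda>_. True"] by simp
    show "{x. P x \<and> Q x} \<in> M" if "{x. P x} \<in> M" "{x. Q x} \<in> M" for P Q
      using Int[OF that] by (simp add: Collect_conj_eq)
    show "{x. Q x} \<in> M" if "\<forall>x. P x \<longrightarrow> Q x" "{x. P x} \<in> M" for P Q
      using mono[OF that(2)] that(1) by blast
  qed
  have "p \<le> F" by (simp add: le_filter_def p ev)
  moreover have "p \<noteq> bot"
    using fip[of "{{}}"] by (auto simp: trivial_limit_def p)
  moreover have "eventually (\<lambda>x. x \<in> B) p \<or> eventually (\<lambda>x. x \<notin> B) p" for B
    using dich[of B] by (simp add: p Compl_eq)
  ultimately have "p \<in> ultrafilters_on S"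
    using F(1) order_trans[of p F "principal S"] by (simp add: ultrafilters_on_def)
  then show ?thesis using \<open>p \<le> F\<close> by blast
qed

lemma compact_Stone_Cech: "compact_space (Stone_Cech S)"
  unfolding compact_space
proof (intro allI impI)
  fix \<U> assume "(\<forall>U\<in>\<U>. openin (Stone_Cech S) U) \<and> \<Union>\<U> = topspace (Stone_Cech S)"
  then have op: "\<And>U. U \<in> \<U> \<Longrightarrow> openin (Stone_Cech S) U" and un: "\<Union>\<U> = ultrafilters_on S"
    by auto
  define \<B> where "\<B> = {B. B \<subseteq> S \<and> (\<exists>U\<in>\<U>. {q \<in> ultrafilters_on S. eventually (\<lambda>x. x \<in> B) q} \<subseteq> U)}"
  have cov: "\<exists>B\<in>\<B>. eventually (\<lambda>x. x \<in> B) p" if p: "p \<in> ultrafilters_on S" for p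
  proof -
    obtain U where U: "U \<in> \<U>" "p \<in> U" using un p by blast
    then obtain B where "B \<subseteq> S" "eventually (\<lambda>x. x \<in> B) p"
      "{q \<in> ultrafilters_on S. eventually (\<lambda>x. x \<in> B) q} \<subseteq> U"
      using op[OF U(1)] unfolding openin_Stone_Cech by blast
    with U(1) show ?thesis unfolding \<B>_def by blast
  qed
  have "\<exists>\<F>\<subseteq>\<B>. finite \<F> \<and> S \<subseteq> \<Union>\<F>"
  proof (rule ccontr)
    assume no: "\<not> ?thesis"
    define F where "F = (INF B\<in>insert {} \<B>. principal (S - B))"
    have "F \<noteq> bot"
    proof
      assume "F = bot"
      then have "eventually (\<lambda>_. False) F" by simp
      then obtain X where X: "X \<subseteq> insert {} \<B>" "finite X"
        and "eventually (\<lambda>_. False) (INF B\<in>X. principal (S - B))"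
        unfolding F_def eventually_INF[of _ _ "insert {} \<B>"] by blast
      then have "eventually (\<lambda>_. False) (principal (\<Inter>B\<in>X. S - B))"
        using INF_principal_finite[OF X(2), of "\<lambda>B. S - B"] by simp
      then have "(\<Inter>B\<in>X. S - B) = {}" by (simp add: eventually_principal)
      then have "S \<subseteq> \<Union>(X - {{}})" by blast
      moreover have "X - {{}} \<subseteq> \<B>" "finite (X - {{}})" using X by auto
      ultimately show False using no by blast
    qed
    moreover have "F \<le> principal (S - {})"
      unfolding F_def by (rule INF_lower) blast
    ultimately obtain p where p: "p \<in> ultrafilters_on S" "p \<le> F"
      using ex_ultrafilter[of F S] by auto
    obtain B where B: "B \<in> \<B>" "eventually (\<lambda>x. x \<in> B) p" using cov[OF p(1)] by blast
    have "F \<le> principal (S - B)" unfolding F_def using B(1) by (intro INF_lower) blast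
    with p(2) have "eventually (\<lambda>x. x \<in> S - B) p"
      using le_principal order_trans by blast
    then have "eventually (\<lambda>x. x \<notin> B) p" by (rule eventually_mono) simp
    then show False using B(2) ultrafilters_onD(3)[OF p(1)] by blast
  qed
  then obtain \<F> where F: "\<F> \<subseteq> \<B>" "finite \<F>" "S \<subseteq> \<Union>\<F>" by blast
  then have "\<forall>B\<in>\<F>. \<exists>U\<in>\<U>. {q \<in> ultrafilters_on S. eventually (\<lambda>x. x \<in> B) q} \<subseteq> U"
    unfolding \<B>_def by blast
  then obtain u where u: "\<And>B. B \<in> \<F> \<Longrightarrow> u B \<in> \<U>"
    "\<And>B. B \<in> \<F> \<Longrightarrow> {q \<in> ultrafilters_on S. eventually (\<lambda>x. x \<in> B) q} \<subseteq> u B" by metis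
  have "\<Union>(u ` \<F>) = topspace (Stone_Cech S)"
  proof
    show "\<Union>(u ` \<F>) \<subseteq> topspace (Stone_Cech S)" using u(1) un by auto
    show "topspace (Stone_Cech S) \<subseteq> \<Union>(u ` \<F>)"
    proof
      fix p assume "p \<in> topspace (Stone_Cech S)"
      then have p: "p \<in> ultrafilters_on S" by simp
      have "eventually (\<lambda>x. \<exists>B\<in>\<F>. x \<in> B) p"
        using ultrafilters_onD(2)[OF p] by (rule eventually_mono) (use F(3) in blast)
      then obtain B where "B \<in> \<F>" "eventually (\<lambda>x. x \<in> B) p"
        using ultrafilter_finite_UN[OF p F(2), of "\<lambda>B x. x \<in> B"] by blast
      then show "p \<in> \<Union>(u ` \<F>)" using u(2) p by blast
    qed
  qed
  then show "\<exists>\<F>. finite \<F> \<and> \<F> \<subseteq> \<U> \<and> \<Union>\<F> = topspace (Stone_Cech S)"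
    using F(2) u(1) by (intro exI[of _ "u ` \<F>"]) auto
qed

lemma embedding_Stone_Cech:
  "embedding_map (discrete_topology S) (Stone_Cech S) (\<lambda>s. principal {s})"
proof (rule injective_open_imp_embedding_map)
  show "continuous_map (discrete_topology S) (Stone_Cech S) (\<lambda>s. principal {s})" by auto
  have "openin (Stone_Cech S) ((\<lambda>s. principal {s}) ` U)" if "U \<subseteq> S" for U
    unfolding openin_Stone_Cech
  proof (intro conjI ballI)
    fix p assume "p \<in> (\<lambda>s. principal {s}) ` U"
    then obtain s where s: "s \<in> U" "p = principal {s}" by blast
    have "q = principal {s}" if "q \<in> ultrafilters_on S" "eventually (\<lambda>x. x \<in> {s}) q" for q
    proof (rule filter_eq_iff[THEN iffD2], rule allI)
      fix P
      show "eventually P q \<longleftrightarrow> eventually P (principal {s})"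
      proof (cases "P s")
        case True
        then show ?thesis using that(2) by (auto simp: eventually_principal elim: eventually_mono)
      next
        case False
        then have "eventually (\<lambda>x. \<not> P x) q"
          using that(2) by (auto elim: eventually_mono)
        then show ?thesis
          using False ultrafilters_onD(3)[OF that(1), of P] by (auto simp: eventually_principal)
      qed
    qed
    then show "\<exists>B\<subseteq>S. eventually (\<lambda>x. x \<in> B) p \<and>
        {q \<in> ultrafilters_on S. eventually (\<lambda>x. x \<in> B) q} \<subseteq> (\<lambda>s. principal {s}) ` U"
      using s \<open>U \<subseteq> S\<close> by (intro exI[of _ "{s}"]) (auto simp: eventually_principal)
  qed (use \<open>U \<subseteq> S\<close> in auto)
  then show "open_map (discrete_topology S) (Stone_Cech S) (\<lambda>s. principal {s})"
    by (simp add: open_map_def)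
  show "inj_on (\<lambda>s. principal {s}) (topspace (discrete_topology S))"
    by (auto simp: inj_on_def)
qed

lemma dense_Stone_Cech:
  "Stone_Cech S closure_of ((\<lambda>s. principal {s}) ` S) = topspace (Stone_Cech S)"
proof -
  have "\<exists>s\<in>S. principal {s} \<in> U" if U: "openin (Stone_Cech S) U" "p \<in> U" for U p
  proof -
    obtain B where B: "B \<subseteq> S" "eventually (\<lambda>x. x \<in> B) p"
      "{q \<in> ultrafilters_on S. eventually (\<lambda>x. x \<in> B) q} \<subseteq> U" and p: "p \<in> ultrafilters_on S"
      using U unfolding openin_Stone_Cech by blast
    then obtain s where "s \<in> B"
      using eventually_happens[OF B(2)] ultrafilters_onD(1)[OF p] by auto
    then have "principal {s} \<in> U" using B by (force simp: eventually_principal)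
    then show ?thesis using \<open>s \<in> B\<close> B(1) by blast
  qed
  then show ?thesis by (fastforce simp: closure_of_def)
qed

theorem Stone_Cech_extension:
  assumes Y: "compact_space Y" "Hausdorff_space Y" and f: "f ` S \<subseteq> topspace Y"
  shows "\<exists>h. continuous_map (Stone_Cech S) Y h \<and> (\<forall>s\<in>S. h (principal {s}) = f s)"
proof -
  have ex: "\<exists>y\<in>topspace Y. \<forall>U. openin Y U \<longrightarrow> y \<in> U \<longrightarrow> eventually (\<lambda>x. f x \<in> U) p"
    if p: "p \<in> ultrafilters_on S" for p
  proof (rule ccontr)
    assume "\<not> ?thesis"
    then have "\<forall>y\<in>topspace Y. \<exists>U. openin Y U \<and> y \<in> U \<and> \<not> eventually (\<lambda>x. f x \<in> U) p" by blast
    then obtain U where U: "\<And>y. y \<in> topspace Y \<Longrightarrow>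
        openin Y (U y) \<and> y \<in> U y \<and> \<not> eventually (\<lambda>x. f x \<in> U y) p" by metis
    have "U y \<subseteq> topspace Y" if "y \<in> topspace Y" for y
      using U[OF that] openin_subset[of Y "U y"] by blast
    then have "\<Union>(U ` topspace Y) \<subseteq> topspace Y" by blast
    moreover have "topspace Y \<subseteq> \<Union>(U ` topspace Y)"
    proof
      fix y assume y: "y \<in> topspace Y"
      then have "y \<in> U y" using U by simp
      with y show "y \<in> \<Union>(U ` topspace Y)" by blast
    qed
    ultimately have "\<Union>(U ` topspace Y) = topspace Y" by (rule equalityI)
    moreover have "\<forall>V\<in>U ` topspace Y. openin Y V"
    proof
      fix V assume "V \<in> U ` topspace Y"
      then obtain y where "y \<in> topspace Y" "V = U y" by blast
      then show "openin Y V" using U[of y] by simp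
    qed
    ultimately have "\<exists>\<F>. finite \<F> \<and> \<F> \<subseteq> U ` topspace Y \<and> \<Union>\<F> = topspace Y"
      by (intro Y(1)[unfolded compact_space, rule_format] conjI)
    then obtain \<F> where \<F>: "finite \<F>" "\<F> \<subseteq> U ` topspace Y" "\<Union>\<F> = topspace Y"
      by (elim exE conjE)
    have "eventually (\<lambda>x. \<exists>V\<in>\<F>. f x \<in> V) p"
      using ultrafilters_onD(2)[OF p] by (rule eventually_mono) (use f \<F>(3) in blast)
    then obtain V where V: "V \<in> \<F>" "eventually (\<lambda>x. f x \<in> V) p"
      using ultrafilter_finite_UN[OF p \<F>(1), of "\<lambda>V x. f x \<in> V"] by blast
    then obtain y where "y \<in> topspace Y" "V = U y" using \<F>(2) by blast
    then show False using V(2) U[of y] by simp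
  qed
  have "\<exists>h. \<forall>p\<in>ultrafilters_on S. h p \<in> topspace Y \<and>
      (\<forall>U. openin Y U \<longrightarrow> h p \<in> U \<longrightarrow> eventually (\<lambda>x. f x \<in> U) p)"
    by (rule bchoice) (use ex in blast)
  then obtain h0 where h0: "\<And>p. p \<in> ultrafilters_on S \<Longrightarrow> h0 p \<in> topspace Y"
    "\<And>p U. p \<in> ultrafilters_on S \<Longrightarrow> openin Y U \<Longrightarrow> h0 p \<in> U \<Longrightarrow> eventually (\<lambda>x. f x \<in> U) p"
    by blast
  have "h0 (principal {s}) = f s" if s: "s \<in> S" for s
  proof (rule ccontr)
    assume "h0 (principal {s}) \<noteq> f s"
    then obtain U V where "openin Y U" "openin Y V" "h0 (principal {s}) \<in> U" "f s \<in> V" "disjnt U V"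
      using Y(2)[unfolded Hausdorff_space_def, rule_format, of "h0 (principal {s})" "f s"]
        h0(1)[of "principal {s}"] s f by auto
    then show False
      using h0(2)[of "principal {s}" U] s by (auto simp: eventually_principal disjnt_iff)
  qed
  moreover have "continuous_map (Stone_Cech S) Y h0"
    unfolding continuous_map_def
  proof (intro conjI allI impI)
    show "h0 \<in> topspace (Stone_Cech S) \<rightarrow> topspace Y" using h0(1) by auto
    fix V assume V: "openin Y V"
    show "openin (Stone_Cech S) {p \<in> topspace (Stone_Cech S). h0 p \<in> V}"
      unfolding openin_Stone_Cech
    proof (intro conjI ballI)
      fix p assume "p \<in> {p \<in> topspace (Stone_Cech S). h0 p \<in> V}"
      then have p: "p \<in> ultrafilters_on S" "h0 p \<in> V" by auto
      have "neighbourhood_base_of (closedin Y) Y"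
        unfolding neighbourhood_base_of_closedin
        using Y by (rule compact_Hausdorff_imp_regular_space)
      then have "\<exists>U W. openin Y U \<and> closedin Y W \<and> h0 p \<in> U \<and> U \<subseteq> W \<and> W \<subseteq> V"
        using V p(2) unfolding neighbourhood_base_of by simp
      then obtain U W where UW: "openin Y U" "closedin Y W" "h0 p \<in> U" "U \<subseteq> W" "W \<subseteq> V"
        by (elim exE conjE)
      have "h0 q \<in> W" if q: "q \<in> ultrafilters_on S" "eventually (\<lambda>x. x \<in> {x \<in> S. f x \<in> U}) q" for q
      proof (rule ccontr)
        assume "h0 q \<notin> W"
        then have "eventually (\<lambda>x. f x \<in> topspace Y - W) q"
          using h0(1)[OF q(1)] UW(2) by (intro h0(2)[OF q(1)]) auto
        with q(2) have "eventually (\<lambda>x. False) q"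
          by eventually_elim (use UW(4) in auto)
        then show False using ultrafilters_onD(1)[OF q(1)] by (simp add: trivial_limit_def)
      qed
      moreover have "eventually (\<lambda>x. x \<in> {x \<in> S. f x \<in> U}) p"
        using h0(2)[OF p(1) UW(1,3)] ultrafilters_onD(2)[OF p(1)] by (simp add: eventually_conj_iff)
      ultimately show "\<exists>B\<subseteq>S. eventually (\<lambda>x. x \<in> B) p \<and>
          {q \<in> ultrafilters_on S. eventually (\<lambda>x. x \<in> B) q} \<subseteq> {p \<in> topspace (Stone_Cech S). h0 p \<in> V}"
        using UW(5) by (intro exI[of _ "{x \<in> S. f x \<in> U}"]) auto
    qed auto
  qed
  ultimately show ?thesis by blast
qed

lemma Stone_Cech_action_principal:
  assumes "h \<in> carrier G"
  shows "Stone_Cech_action G g (principal {h}) = principal {g \<otimes>\<^bsub>G\<^esub> h}"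
  using assms by (simp add: Stone_Cech_action_def)

theorem Stone_Cech_G_space:
  assumes "group G"
  shows "locally_compact_G_space G (Stone_Cech (carrier G)) (Stone_Cech_action G)"
proof -
  interpret group G by fact
  let ?S = "carrier G" and ?\<phi> = "Stone_Cech_action G"
  have closed: "?\<phi> g p \<in> ultrafilters_on ?S" if g: "g \<in> ?S" and p: "p \<in> ultrafilters_on ?S" for g p
  proof -
    have "eventually (\<lambda>x. g \<otimes>\<^bsub>G\<^esub> x \<in> ?S) p"
      using ultrafilters_onD(2)[OF p] g by (auto elim: eventually_mono)
    then have "filtermap (\<lambda>h. g \<otimes>\<^bsub>G\<^esub> h) p \<in> ultrafilters_on ?S"
      using ultrafilters_onD[OF p]
      by (auto simp: ultrafilters_on_def le_principal eventually_filtermap filtermap_bot_iff)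
    then show ?thesis using p by (simp add: Stone_Cech_action_def)
  qed
  have mult: "?\<phi> (g \<otimes>\<^bsub>G\<^esub> h) p = ?\<phi> g (?\<phi> h p)"
    if "g \<in> ?S" "h \<in> ?S" and p: "p \<in> ultrafilters_on ?S" for g h p
  proof -
    have "filtermap (\<lambda>x. g \<otimes>\<^bsub>G\<^esub> h \<otimes>\<^bsub>G\<^esub> x) p = filtermap (\<lambda>x. g \<otimes>\<^bsub>G\<^esub> (h \<otimes>\<^bsub>G\<^esub> x)) p"
      using ultrafilters_onD(2)[OF p] that
      by (intro filtermap_eqI) (auto elim!: eventually_mono simp: m_assoc)
    then show ?thesis
      using p closed[OF that(2) p] by (simp add: Stone_Cech_action_def filtermap_filtermap)
  qed
  have one: "?\<phi> \<one>\<^bsub>G\<^esub> p = p" if p: "p \<in> ultrafilters_on ?S" for p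
  proof -
    have "filtermap (\<lambda>x. \<one>\<^bsub>G\<^esub> \<otimes>\<^bsub>G\<^esub> x) p = filtermap (\<lambda>x. x) p"
      using ultrafilters_onD(2)[OF p] by (intro filtermap_eqI) (auto elim!: eventually_mono)
    then show ?thesis using p by (simp add: Stone_Cech_action_def filtermap_ident)
  qed
  have Bij: "?\<phi> g \<in> Bij (ultrafilters_on ?S)" if g: "g \<in> ?S" for g
  proof -
    have "bij_betw (?\<phi> g) (ultrafilters_on ?S) (ultrafilters_on ?S)"
    proof (rule bij_betw_byWitness[where f' = "?\<phi> (inv\<^bsub>G\<^esub> g)"])
      show "\<forall>p\<in>ultrafilters_on ?S. ?\<phi> (inv\<^bsub>G\<^esub> g) (?\<phi> g p) = p"
        "\<forall>p\<in>ultrafilters_on ?S. ?\<phi> g (?\<phi> (inv\<^bsub>G\<^esub> g) p) = p"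
        using g one mult[of "inv\<^bsub>G\<^esub> g" g] mult[of g "inv\<^bsub>G\<^esub> g"] by auto
    qed (use closed g in auto)
    then show ?thesis by (simp add: Bij_def Stone_Cech_action_def)
  qed
  have "group_hom G (BijGroup (ultrafilters_on ?S)) ?\<phi>"
  proof (intro group_hom.intro group_hom_axioms.intro homI)
    show "?\<phi> g \<in> carrier (BijGroup (ultrafilters_on ?S))" if "g \<in> ?S" for g
      using Bij[OF that] by (simp add: BijGroup_def)
    show "?\<phi> (g \<otimes>\<^bsub>G\<^esub> h) = ?\<phi> g \<otimes>\<^bsub>BijGroup (ultrafilters_on ?S)\<^esub> ?\<phi> h" if "g \<in> ?S" "h \<in> ?S" for g h
    proof
      fix p
      show "?\<phi> (g \<otimes>\<^bsub>G\<^esub> h) p = (?\<phi> g \<otimes>\<^bsub>BijGroup (ultrafilters_on ?S)\<^esub> ?\<phi> h) p"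
        using that mult Bij
        by (cases "p \<in> ultrafilters_on ?S") (auto simp: BijGroup_def compose_def Stone_Cech_action_def)
    qed
  qed (auto simp: group_BijGroup \<open>group G\<close>)
  moreover have "continuous_map (Stone_Cech ?S) (Stone_Cech ?S) (?\<phi> g)" if g: "g \<in> ?S" for g
    unfolding continuous_map_def
  proof (intro conjI allI impI)
    show "?\<phi> g \<in> topspace (Stone_Cech ?S) \<rightarrow> topspace (Stone_Cech ?S)" using closed g by auto
    fix U assume U: "openin (Stone_Cech ?S) U"
    show "openin (Stone_Cech ?S) {p \<in> topspace (Stone_Cech ?S). ?\<phi> g p \<in> U}"
      unfolding openin_Stone_Cech
    proof (intro conjI ballI)
      fix p assume "p \<in> {p \<in> topspace (Stone_Cech ?S). ?\<phi> g p \<in> U}"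
      then have p: "p \<in> ultrafilters_on ?S" "?\<phi> g p \<in> U" by auto
      then obtain B where B: "B \<subseteq> ?S" "eventually (\<lambda>x. x \<in> B) (?\<phi> g p)"
        "{q \<in> ultrafilters_on ?S. eventually (\<lambda>x. x \<in> B) q} \<subseteq> U"
        using U unfolding openin_Stone_Cech by blast
      have ev: "eventually (\<lambda>x. x \<in> {x \<in> ?S. g \<otimes>\<^bsub>G\<^esub> x \<in> B}) q \<longleftrightarrow> eventually (\<lambda>x. x \<in> B) (?\<phi> g q)"
        if q: "q \<in> ultrafilters_on ?S" for q
        using q ultrafilters_onD(2)[OF q]
        by (simp add: Stone_Cech_action_def eventually_filtermap eventually_conj_iff)
      show "\<exists>B\<subseteq>?S. eventually (\<lambda>x. x \<in> B) p \<and>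
          {q \<in> ultrafilters_on ?S. eventually (\<lambda>x. x \<in> B) q}
            \<subseteq> {p \<in> topspace (Stone_Cech ?S). ?\<phi> g p \<in> U}"
      proof (intro exI[of _ "{x \<in> ?S. g \<otimes>\<^bsub>G\<^esub> x \<in> B}"] conjI)
        show "eventually (\<lambda>x. x \<in> {x \<in> ?S. g \<otimes>\<^bsub>G\<^esub> x \<in> B}) p" using ev[OF p(1)] B(2) by simp
        show "{q \<in> ultrafilters_on ?S. eventually (\<lambda>x. x \<in> {x \<in> ?S. g \<otimes>\<^bsub>G\<^esub> x \<in> B}) q}
            \<subseteq> {p \<in> topspace (Stone_Cech ?S). ?\<phi> g p \<in> U}"
        proof
          fix q assume "q \<in> {q \<in> ultrafilters_on ?S. eventually (\<lambda>x. x \<in> {x \<in> ?S. g \<otimes>\<^bsub>G\<^esub> x \<in> B}) q}"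
          then have "q \<in> ultrafilters_on ?S" "eventually (\<lambda>x. x \<in> B) (?\<phi> g q)" using ev by auto
          then show "q \<in> {p \<in> topspace (Stone_Cech ?S). ?\<phi> g p \<in> U}"
            using B(3) closed[OF g] by auto
        qed
      qed auto
    qed auto
  qed
  moreover have "locally_compact_space (Stone_Cech ?S)"
    using compact_Stone_Cech by (rule compact_imp_locally_compact_space)
  ultimately show ?thesis
    using Hausdorff_Stone_Cech
    by (auto simp: locally_compact_G_space_def group_action_def locally_compact_G_space_axioms_def)
qed

end

theory Submission
  imports Defs
begin

text \<open>
  The multiplication of \<open>G\<close> extends to a product \<open>p \<star> q\<close> on \<open>\<beta>G\<close> for which every right
  multiplication is continuous and \<open>G\<close>-equivariant.  Let \<open>(X, x\<^sub>0)\<close> be a minimal pointed space of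
  type \<open>[A]\<close>.  Then \<open>X\<^sub>A\<close> consists of exactly those ultrafilters \<open>p\<close> along which \<open>g \<mapsto> g.x\<^sub>0\<close>
  converges in \<open>X\<close>; let \<open>T\<close> be the set of those along which it converges to \<open>x\<^sub>0\<close>.  Then \<open>T\<close> is
  a compact subsemigroup of \<open>\<beta>G\<close>, and minimality of \<open>X\<close> shows that \<open>T\<close> meets every minimal closed
  invariant set.  If \<open>q \<in> N \<inter> T\<close>, right multiplication by \<open>q\<close> maps \<open>X\<^sub>A\<close> to \<open>N\<close>, and an
  idempotent of \<open>M \<inter> T\<close> acts as the identity on \<open>M\<close>, because its fixed points form a closed
  invariant set.  For \<open>q \<in> M \<inter> T\<close> the set \<open>(N \<inter> T) \<star> q\<close> is a compact subsemigroup of \<open>M \<inter> T\<close>,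
  so by Ellis' lemma it contains an idempotent \<open>r \<star> q\<close>: the map \<open>N \<rightarrow> M\<close> given by \<open>q\<close> has a right
  inverse given by some \<open>r \<in> N \<inter> T\<close>.  Applying this also to \<open>r\<close> shows that these maps are
  mutually inverse.
\<close>

section \<open>Idempotents in compact semigroups\<close>

text \<open>Ellis' lemma. Every element \<open>e\<close> of a minimal closed subsemigroup
  \<open>C\<close> of \<open>D\<close> is idempotent: the right translate of \<open>C\<close> by
  \<open>e\<close> is again a closed subsemigroup, hence equal to \<open>C\<close>, so some
  \<open>x\<close> in \<open>C\<close> satisfies \<open>m x e = e\<close>; the set of all such
  \<open>x\<close> is a closed subsemigroup too, hence contains \<open>e\<close>.\<close>

lemma compact_right_topological_idempotent:
  assumes X: "compact_space X" "Hausdorff_space X" and D: "closedin X D" "D \<noteq> {}"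
    and closed: "\<And>x y. x \<in> D \<Longrightarrow> y \<in> D \<Longrightarrow> m x y \<in> D"
    and assoc: "\<And>x y z. x \<in> D \<Longrightarrow> y \<in> D \<Longrightarrow> z \<in> D \<Longrightarrow> m (m x y) z = m x (m y z)"
    and cont: "\<And>y. y \<in> D \<Longrightarrow> continuous_map X X (\<lambda>x. m x y)"
  shows "\<exists>e\<in>D. m e e = e"
proof -
  \<comment> \<open>Zorn's lemma is applied to complements: \<open>U\<close> stands for the closed
    subsemigroup \<open>D - U\<close>, so a maximal \<open>U\<close> gives a minimal subsemigroup,
    and chains are bounded by unions.\<close>
  define \<A> where "\<A> = {U. openin X U \<and> \<not> D \<subseteq> U \<and> (\<forall>x\<in>D - U. \<forall>y\<in>D - U. m x y \<notin> U)}"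
  have "\<exists>U\<in>\<A>. \<forall>V\<in>\<A>. U \<subseteq> V \<longrightarrow> V = U"
  proof (rule subset_Zorn_nonempty)
    have "{} \<in> \<A>" using D by (auto simp: \<A>_def)
    then show "\<A> \<noteq> {}" by blast
  next
    fix \<C> assume ne: "\<C> \<noteq> {}" and ch: "subset.chain \<A> \<C>"
    have sub: "\<C> \<subseteq> \<A>" using ch unfolding subset_chain_def by blast
    \<comment> \<open>By compactness finitely many members of the chain would cover
      \<open>D\<close>, and then the largest of them alone would.\<close>
    have "\<not> D \<subseteq> \<Union>\<C>"
    proof
      assume cov: "D \<subseteq> \<Union>\<C>"
      have "openin X U" if "U \<in> \<C>" for U using that sub by (auto simp: \<A>_def)
      from compactinD[OF closedin_compact_space[OF X(1) D(1)] this cov]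
      obtain \<F> where \<F>: "finite \<F>" "\<F> \<subseteq> \<C>" "D \<subseteq> \<Union>\<F>" by auto
      have "\<F> \<noteq> {}" using \<F>(3) D(2) by auto
      moreover have "subset.chain \<A> \<F>"
        using ch \<F>(2) sub by (simp add: subset_chain_def subset_iff)
      ultimately have "\<Union>\<F> \<in> \<F>" by (rule Union_in_chain[OF \<F>(1)])
      then have "\<Union>\<F> \<in> \<A>" using \<F>(2) sub by blast
      then have "\<not> D \<subseteq> \<Union>\<F>" unfolding \<A>_def by blast
      then show False using \<F>(3) by contradiction
    qed
    moreover have "openin X (\<Union>\<C>)" using sub by (auto simp: \<A>_def)
    moreover have "m x y \<notin> \<Union>\<C>" if "x \<in> D - \<Union>\<C>" "y \<in> D - \<Union>\<C>" for x y
      using that sub by (auto simp: \<A>_def)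
    ultimately show "\<Union>\<C> \<in> \<A>" by (simp add: \<A>_def)
  qed
  then obtain U where U: "U \<in> \<A>" and max: "\<And>V. V \<in> \<A> \<Longrightarrow> U \<subseteq> V \<Longrightarrow> V = U" by blast
  define C where "C = D - U"
  have "openin X U" "\<not> D \<subseteq> U" and Umult: "\<And>x y. x \<in> D - U \<Longrightarrow> y \<in> D - U \<Longrightarrow> m x y \<notin> U"
    using U unfolding \<A>_def by blast+
  then have C: "closedin X C" "C \<noteq> {}" "C \<subseteq> D"
    using closedin_diff[OF D(1)] unfolding C_def by blast+
  have Cmult: "m x y \<in> C" if "x \<in> C" "y \<in> C" for x y
    using Umult[of x y] closed[of x y] that unfolding C_def by blast
  have min: "C' = C"
    if C': "closedin X C'" "C' \<noteq> {}" "C' \<subseteq> C" "\<And>x y. x \<in> C' \<Longrightarrow> y \<in> C' \<Longrightarrow> m x y \<in> C'" for C'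
  proof -
    let ?V = "topspace X - C'"
    have Dtop: "D \<subseteq> topspace X" using D(1) by (rule closedin_subset)
    have "U \<subseteq> topspace X" using \<open>openin X U\<close> by (rule openin_subset)
    then have "U \<subseteq> ?V" using C'(3) by (auto simp: C_def)
    moreover have "D - ?V = C'" using C'(3) Dtop by (auto simp: C_def)
    moreover from this have "?V \<in> \<A>"
      unfolding \<A>_def using C'(1,2,4) by (simp add: closedin_def) blast
    ultimately have "?V = U" by (intro max)
    with \<open>D - ?V = C'\<close> show ?thesis by (simp add: C_def)
  qed
  obtain e where e: "e \<in> C" using C(2) by blast
  then have eD: "e \<in> D" using C(3) by blast
  have "(\<lambda>x. m x e) ` C = C"
  proof (rule min)
    have "compactin X ((\<lambda>x. m x e) ` C)"
      using image_compactin[OF closedin_compact_space[OF X(1) C(1)] cont[OF eD]] .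
    then show "closedin X ((\<lambda>x. m x e) ` C)" by (rule compactin_imp_closedin[OF X(2)])
    fix x y assume "x \<in> (\<lambda>x. m x e) ` C" "y \<in> (\<lambda>x. m x e) ` C"
    then obtain a b where ab: "a \<in> C" "b \<in> C" "x = m a e" "y = m b e" by blast
    \<comment> \<open>Associativity moves the last factor \<open>e\<close> outside: (ae)(be) =
      ((ae)b)e.\<close>
    then have "m x y = m (m (m a e) b) e"
      using assoc[of "m a e" b e] C(3) e Cmult by (simp add: subset_iff)
    moreover have "m (m a e) b \<in> C" using ab e Cmult by simp
    ultimately show "m x y \<in> (\<lambda>x. m x e) ` C" by blast
  next
    show "(\<lambda>x. m x e) ` C \<noteq> {}" using C(2) by blast
    show "(\<lambda>x. m x e) ` C \<subseteq> C" using Cmult e by blast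
  qed
  with e have "e \<in> (\<lambda>x. m x e) ` C" by (simp only:)
  then obtain x where x: "e = m x e" "x \<in> C" by (rule imageE)
  have ne: "x \<in> {x \<in> C. m x e = e}" using x(2) x(1)[symmetric] by (intro CollectI conjI)
  have "{x \<in> C. m x e = e} = C"
  proof (rule min)
    have "closedin X {x \<in> topspace X. m x e = e}"
      using closedin_subset[OF C(1)] e
      by (intro closedin_continuous_maps_eq[OF X(2) cont[OF eD]]) auto
    then have "closedin X (C \<inter> {x \<in> topspace X. m x e = e})" by (rule closedin_Int[OF C(1)])
    moreover have "C \<inter> {x \<in> topspace X. m x e = e} = {x \<in> C. m x e = e}"
      using closedin_subset[OF C(1)] by auto
    ultimately show "closedin X {x \<in> C. m x e = e}" by simp
    show "m x y \<in> {x \<in> C. m x e = e}"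
      if "x \<in> {x \<in> C. m x e = e}" "y \<in> {x \<in> C. m x e = e}" for x y
      using that assoc[of x y e] C(3) e Cmult[of x y] by (simp add: subset_iff)
  qed (use ne in blast)+
  then show ?thesis using e eD by blast
qed


section \<open>The semigroup structure of the Stone--Cech compactification\<close>

context group
begin

text \<open>\<open>p \<star> q\<close> is the limit of the translates of \<open>q\<close> by
  \<open>g\<close> as \<open>g\<close> runs along \<open>p\<close>. Taking \<open>p\<close> as the
  outer quantifier makes the product continuous in its left factor.\<close>

definition filter_mult :: "'a filter \<Rightarrow> 'a filter \<Rightarrow> 'a filter" (infixl "\<star>" 70) where
  "p \<star> q = Abs_filter (\<lambda>P. \<forall>\<^sub>F g in p. \<forall>\<^sub>F h in q. P (g \<otimes> h))"

lemma eventually_filter_mult: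
  "eventually P (p \<star> q) \<longleftrightarrow> (\<forall>\<^sub>F g in p. \<forall>\<^sub>F h in q. P (g \<otimes> h))"
  unfolding filter_mult_def
proof (rule eventually_Abs_filter, rule is_filter.intro)
  show "\<forall>\<^sub>F g in p. \<forall>\<^sub>F h in q. P (g \<otimes> h) \<and> Q (g \<otimes> h)"
    if "\<forall>\<^sub>F g in p. \<forall>\<^sub>F h in q. P (g \<otimes> h)" "\<forall>\<^sub>F g in p. \<forall>\<^sub>F h in q. Q (g \<otimes> h)" for P Q
    using that by (simp add: eventually_conj_iff)
  show "\<forall>\<^sub>F g in p. \<forall>\<^sub>F h in q. Q (g \<otimes> h)"
    if "\<forall>x. P x \<longrightarrow> Q x" "\<forall>\<^sub>F g in p. \<forall>\<^sub>F h in q. P (g \<otimes> h)" for P Q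
    using that(2) by (rule eventually_mono) (use that(1) in \<open>auto elim: eventually_mono\<close>)
qed simp

text \<open>Group identities hold only on the carrier, so predicates under \<open>eventually\<close>
  have to be compared there alone.\<close>

lemma eventually_cong_ultrafilter:
  assumes "p \<in> ultrafilters_on S" "\<And>x. x \<in> S \<Longrightarrow> P x \<longleftrightarrow> Q x"
  shows "eventually P p \<longleftrightarrow> eventually Q p"
  using ultrafilters_onD(2)[OF assms(1)]
  by (intro eventually_subst) (auto elim: eventually_mono simp: assms(2))

lemma filter_mult_ultrafilter:
  assumes p: "p \<in> ultrafilters_on (carrier G)" and q: "q \<in> ultrafilters_on (carrier G)"
  shows "p \<star> q \<in> ultrafilters_on (carrier G)"
proof -
  have "\<forall>\<^sub>F g in p. \<forall>\<^sub>F h in q. g \<otimes> h \<in> carrier G"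
    using ultrafilters_onD(2)[OF p]
    by (rule eventually_mono) (auto intro: eventually_mono[OF ultrafilters_onD(2)[OF q]])
  moreover have "p \<star> q \<noteq> bot"
    using ultrafilters_onD(1)[OF p] ultrafilters_onD(1)[OF q]
    by (simp add: trivial_limit_def eventually_filter_mult)
  moreover have "eventually (\<lambda>x. x \<in> B) (p \<star> q) \<or> eventually (\<lambda>x. x \<notin> B) (p \<star> q)" for B
    using ultrafilters_onD(3)[OF p, of "\<lambda>g. \<forall>\<^sub>F h in q. g \<otimes> h \<in> B"]
    unfolding eventually_filter_mult ultrafilters_onD(3)[OF q] by blast
  ultimately show ?thesis
    by (simp add: ultrafilters_on_def le_principal eventually_filter_mult)
qed

lemma filter_mult_assoc:
  assumes p: "p \<in> ultrafilters_on (carrier G)" and q: "q \<in> ultrafilters_on (carrier G)"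
    and r: "r \<in> ultrafilters_on (carrier G)"
  shows "p \<star> q \<star> r = p \<star> (q \<star> r)"
proof (rule filter_eq_iff[THEN iffD2], rule allI)
  fix P
  have "(\<forall>\<^sub>F k in r. P (g \<otimes> h \<otimes> k)) \<longleftrightarrow> (\<forall>\<^sub>F k in r. P (g \<otimes> (h \<otimes> k)))"
    if "g \<in> carrier G" "h \<in> carrier G" for g h
    by (rule eventually_cong_ultrafilter[OF r]) (use that in \<open>simp add: m_assoc\<close>)
  then have "(\<forall>\<^sub>F h in q. \<forall>\<^sub>F k in r. P (g \<otimes> h \<otimes> k)) \<longleftrightarrow> (\<forall>\<^sub>F h in q. \<forall>\<^sub>F k in r. P (g \<otimes> (h \<otimes> k)))"
    if "g \<in> carrier G" for g
    using that by (intro eventually_cong_ultrafilter[OF q]) simp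
  then show "eventually P (p \<star> q \<star> r) \<longleftrightarrow> eventually P (p \<star> (q \<star> r))"
    unfolding eventually_filter_mult
    by (intro eventually_cong_ultrafilter[OF p]) simp
qed

lemma continuous_map_filter_mult:
  assumes q: "q \<in> ultrafilters_on (carrier G)"
  shows "continuous_map (Stone_Cech (carrier G)) (Stone_Cech (carrier G)) (\<lambda>p. p \<star> q)"
  unfolding continuous_map_def
proof (intro conjI allI impI)
  show "(\<lambda>p. p \<star> q) \<in> topspace (Stone_Cech (carrier G)) \<rightarrow> topspace (Stone_Cech (carrier G))"
    using filter_mult_ultrafilter q by simp
  fix U assume U: "openin (Stone_Cech (carrier G)) U"
  show "openin (Stone_Cech (carrier G)) {p \<in> topspace (Stone_Cech (carrier G)). p \<star> q \<in> U}"
    unfolding openin_Stone_Cech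
  proof (intro conjI ballI)
    fix p assume "p \<in> {p \<in> topspace (Stone_Cech (carrier G)). p \<star> q \<in> U}"
    then have p: "p \<in> ultrafilters_on (carrier G)" "p \<star> q \<in> U" by auto
    then obtain B where B: "B \<subseteq> carrier G" "eventually (\<lambda>x. x \<in> B) (p \<star> q)"
      "{r \<in> ultrafilters_on (carrier G). eventually (\<lambda>x. x \<in> B) r} \<subseteq> U"
      using U unfolding openin_Stone_Cech by blast
    \<comment> \<open>The preimage of the basic open set of \<open>B\<close> under right
      multiplication by \<open>q\<close> is the basic open set of \<open>?C\<close>.\<close>
    let ?C = "{g \<in> carrier G. \<forall>\<^sub>F h in q. g \<otimes> h \<in> B}"
    have ev: "eventually (\<lambda>x. x \<in> ?C) r \<longleftrightarrow> eventually (\<lambda>x. x \<in> B) (r \<star> q)"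
      if "r \<in> ultrafilters_on (carrier G)" for r
      using ultrafilters_onD(2)[OF that] by (simp add: eventually_filter_mult eventually_conj_iff)
    show "\<exists>B\<subseteq>carrier G. eventually (\<lambda>x. x \<in> B) p \<and>
        {r \<in> ultrafilters_on (carrier G). eventually (\<lambda>x. x \<in> B) r}
          \<subseteq> {p \<in> topspace (Stone_Cech (carrier G)). p \<star> q \<in> U}"
    proof (intro exI[of _ ?C] conjI)
      show "eventually (\<lambda>x. x \<in> ?C) p" using ev p(1) B(2) by blast
      show "{r \<in> ultrafilters_on (carrier G). eventually (\<lambda>x. x \<in> ?C) r}
          \<subseteq> {p \<in> topspace (Stone_Cech (carrier G)). p \<star> q \<in> U}"
      proof
        fix r assume "r \<in> {r \<in> ultrafilters_on (carrier G). eventually (\<lambda>x. x \<in> ?C) r}"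
        then have r: "r \<in> ultrafilters_on (carrier G)" "eventually (\<lambda>x. x \<in> B) (r \<star> q)"
          using ev by blast+
        then have "r \<star> q \<in> U" using B(3) filter_mult_ultrafilter[OF r(1) q] by blast
        then show "r \<in> {p \<in> topspace (Stone_Cech (carrier G)). p \<star> q \<in> U}" using r(1) by simp
      qed
    qed auto
  qed auto
qed

lemma eventually_Stone_Cech_action:
  assumes "p \<in> ultrafilters_on (carrier G)"
  shows "eventually P (Stone_Cech_action G g p) \<longleftrightarrow> (\<forall>\<^sub>F h in p. P (g \<otimes> h))"
  using assms by (simp add: Stone_Cech_action_def eventually_filtermap)

lemma Stone_Cech_action_ultrafilter:
  assumes "g \<in> carrier G" "p \<in> ultrafilters_on (carrier G)"
  shows "Stone_Cech_action G g p \<in> ultrafilters_on (carrier G)"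
proof -
  interpret S: locally_compact_G_space G "Stone_Cech (carrier G)" "Stone_Cech_action G"
    by (rule Stone_Cech_G_space) (rule is_group)
  show ?thesis using S.element_image assms by simp
qed

lemma Stone_Cech_action_filter_mult:
  assumes g: "g \<in> carrier G" and p: "p \<in> ultrafilters_on (carrier G)"
    and q: "q \<in> ultrafilters_on (carrier G)"
  shows "Stone_Cech_action G g (p \<star> q) = Stone_Cech_action G g p \<star> q"
proof (rule filter_eq_iff[THEN iffD2], rule allI)
  fix P
  have "(\<forall>\<^sub>F k in q. P (g \<otimes> (h \<otimes> k))) \<longleftrightarrow> (\<forall>\<^sub>F k in q. P (g \<otimes> h \<otimes> k))"
    if "h \<in> carrier G" for h
    by (rule eventually_cong_ultrafilter[OF q]) (use that g in \<open>simp add: m_assoc\<close>)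
  then show "eventually P (Stone_Cech_action G g (p \<star> q)) \<longleftrightarrow>
      eventually P (Stone_Cech_action G g p \<star> q)"
    unfolding eventually_filter_mult eventually_Stone_Cech_action[OF p]
      eventually_Stone_Cech_action[OF filter_mult_ultrafilter[OF p q]]
    by (intro eventually_cong_ultrafilter[OF p]) simp
qed

text \<open>As a limit of translates of \<open>q\<close>, the product lies in the closure of the
  orbit of \<open>q\<close>: a basic neighbourhood of \<open>p \<star> q\<close> contains the
  translate of \<open>q\<close> by some \<open>g\<close>.\<close>

lemma filter_mult_in_closed_set:
  assumes C: "closedin (Stone_Cech (carrier G)) C"
    and p: "p \<in> ultrafilters_on (carrier G)" and q: "q \<in> ultrafilters_on (carrier G)"
    and orbit: "\<And>g. g \<in> carrier G \<Longrightarrow> Stone_Cech_action G g q \<in> C"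
  shows "p \<star> q \<in> C"
proof (rule ccontr)
  assume "p \<star> q \<notin> C"
  then have "p \<star> q \<in> ultrafilters_on (carrier G) - C"
    using filter_mult_ultrafilter[OF p q] by simp
  moreover have "openin (Stone_Cech (carrier G)) (ultrafilters_on (carrier G) - C)"
    using C by (simp add: closedin_def)
  ultimately obtain B where B: "eventually (\<lambda>x. x \<in> B) (p \<star> q)"
    "{r \<in> ultrafilters_on (carrier G). eventually (\<lambda>x. x \<in> B) r} \<subseteq> ultrafilters_on (carrier G) - C"
    unfolding openin_Stone_Cech by meson
  have "\<forall>\<^sub>F g in p. g \<in> carrier G \<and> (\<forall>\<^sub>F h in q. g \<otimes> h \<in> B)"
    using B(1) ultrafilters_onD(2)[OF p] by (simp add: eventually_filter_mult eventually_conj_iff)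
  then obtain g where g: "g \<in> carrier G" "\<forall>\<^sub>F h in q. g \<otimes> h \<in> B"
    using eventually_happens ultrafilters_onD(1)[OF p] by blast
  then have "eventually (\<lambda>x. x \<in> B) (Stone_Cech_action G g q)"
    by (simp add: eventually_Stone_Cech_action[OF q])
  then show False using B(2) orbit[OF g(1)] Stone_Cech_action_ultrafilter[OF g(1) q] by blast
qed

end


section \<open>The space attached to a set of minimal type\<close>

text \<open>An ultrafilter without \<open>B\<close> contains the complement of \<open>B\<close>,
  which gives a neighbourhood free of principal ultrafilters at points of \<open>B\<close>. If it
  contains \<open>B\<close>, then \<open>B\<close> meets each of its members \<open>C\<close>, so
  every neighbourhood has such a principal ultrafilter.\<close>

lemma K_set_eq:
  assumes "B \<subseteq> carrier G"
  shows "K_set G B = {p \<in> ultrafilters_on (carrier G). eventually (\<lambda>x. x \<in> B) p}"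
proof (intro equalityI subsetI)
  fix p assume p: "p \<in> K_set G B"
  then have pu: "p \<in> ultrafilters_on (carrier G)" by (simp add: K_set_def in_closure_of)
  have "eventually (\<lambda>x. x \<in> B) p"
  proof (rule ccontr)
    assume "\<not> ?thesis"
    then have "eventually (\<lambda>x. x \<notin> B) p" using ultrafilters_onD(3)[OF pu] by blast
    let ?U = "{q \<in> ultrafilters_on (carrier G). eventually (\<lambda>x. x \<in> carrier G - B) q}"
    have "p \<in> ?U"
      using \<open>eventually (\<lambda>x. x \<notin> B) p\<close> pu ultrafilters_onD(2)[OF pu] by (simp add: eventually_conj_iff)
    moreover have "openin (Stone_Cech (carrier G)) ?U"
      by (intro openin_Stone_Cech_basic) blast
    ultimately obtain q where "q \<in> (\<lambda>b. principal {b}) ` B" "q \<in> ?U"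
      using p[unfolded K_set_def in_closure_of, THEN conjunct2, THEN spec, of ?U] by meson
    then obtain b where "b \<in> B" "eventually (\<lambda>x. x \<in> carrier G - B) (principal {b})" by blast
    then show False by (simp add: eventually_principal)
  qed
  with pu show "p \<in> {p \<in> ultrafilters_on (carrier G). eventually (\<lambda>x. x \<in> B) p}" by simp
next
  fix p assume "p \<in> {p \<in> ultrafilters_on (carrier G). eventually (\<lambda>x. x \<in> B) p}"
  then have p: "p \<in> ultrafilters_on (carrier G)" "eventually (\<lambda>x. x \<in> B) p" by auto
  have "\<exists>b\<in>B. principal {b} \<in> U" if U: "openin (Stone_Cech (carrier G)) U" "p \<in> U" for U
  proof -
    obtain C where C: "eventually (\<lambda>x. x \<in> C) p"
      "{q \<in> ultrafilters_on (carrier G). eventually (\<lambda>x. x \<in> C) q} \<subseteq> U"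
      using U unfolding openin_Stone_Cech by meson
    then obtain b where "b \<in> B" "b \<in> C"
      using eventually_happens[OF eventually_conj[OF p(2) C(1)]] ultrafilters_onD(1)[OF p(1)] by auto
    then have "principal {b} \<in> {q \<in> ultrafilters_on (carrier G). eventually (\<lambda>x. x \<in> C) q}"
      using assms by (auto simp: eventually_principal)
    then have "principal {b} \<in> U" by (rule subsetD[OF C(2)])
    then show ?thesis using \<open>b \<in> B\<close> by blast
  qed
  then show "p \<in> K_set G B" using p(1) unfolding K_set_def in_closure_of by auto
qed

text \<open>An ultrafilter containing a finite union of translates of \<open>A\<close> contains one
  of them. In this form \<open>X_set\<close> depends only on the ideal of \<open>A\<close>, which is
  what the type of a pointed space determines.\<close>

lemma in_X_set_iff:
  assumes "group G" and A: "A \<subseteq> carrier G"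
  shows "p \<in> X_set G A \<longleftrightarrow> p \<in> ultrafilters_on (carrier G) \<and>
           (\<exists>B\<in>translate_ideal G A. eventually (\<lambda>x. x \<in> B) p)"
proof -
  interpret group G by fact
  have coset: "g <#\<^bsub>G\<^esub> A \<subseteq> carrier G" if "g \<in> carrier G" for g
    using that A by (rule l_coset_subset_G[rotated])
  have coset_iff: "p \<in> K_set G (g <#\<^bsub>G\<^esub> A) \<longleftrightarrow>
      p \<in> ultrafilters_on (carrier G) \<and> eventually (\<lambda>x. x \<in> g <#\<^bsub>G\<^esub> A) p"
    if "g \<in> carrier G" for g
    using K_set_eq[OF coset[OF that]] by simp
  have ex: "\<exists>g\<in>carrier G. eventually (\<lambda>x. x \<in> g <#\<^bsub>G\<^esub> A) p"
    if p: "p \<in> ultrafilters_on (carrier G)" "eventually (\<lambda>x. x \<in> B) p"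
      and F: "F \<subseteq> carrier G" "finite F" "B \<subseteq> F <#>\<^bsub>G\<^esub> A" for B F
  proof -
    have "eventually (\<lambda>x. \<exists>g\<in>F. x \<in> g <#\<^bsub>G\<^esub> A) p"
      using p(2) by (rule eventually_mono) (use F(3)[unfolded set_mult_def] in \<open>unfold l_coset_def, blast\<close>)
    then show ?thesis
      using ultrafilter_finite_UN[OF p(1) F(2), of "\<lambda>g x. x \<in> g <#\<^bsub>G\<^esub> A"] F(1) by blast
  qed
  have ideal: "g <#\<^bsub>G\<^esub> A \<in> translate_ideal G A" if "g \<in> carrier G" for g
    using coset[OF that] that
    unfolding translate_ideal_def covered_by_translates_def
    by (auto simp: set_mult_def l_coset_def intro!: exI[of _ "{g}"])
  show ?thesis
  proof
    assume "p \<in> X_set G A"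
    then obtain g where g: "g \<in> carrier G" "p \<in> K_set G (g <#\<^bsub>G\<^esub> A)"
      unfolding X_set_def by (rule UN_E)
    then show "p \<in> ultrafilters_on (carrier G) \<and>
        (\<exists>B\<in>translate_ideal G A. eventually (\<lambda>x. x \<in> B) p)"
      using ideal[OF g(1)] coset_iff[OF g(1)] by blast
  next
    assume "p \<in> ultrafilters_on (carrier G) \<and>
      (\<exists>B\<in>translate_ideal G A. eventually (\<lambda>x. x \<in> B) p)"
    then obtain B F where p: "p \<in> ultrafilters_on (carrier G)" "eventually (\<lambda>x. x \<in> B) p"
      and F: "F \<subseteq> carrier G" "finite F" "B \<subseteq> F <#>\<^bsub>G\<^esub> A"
      unfolding translate_ideal_def covered_by_translates_def by auto
    obtain g where "g \<in> carrier G" "eventually (\<lambda>x. x \<in> g <#\<^bsub>G\<^esub> A) p"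
      using ex[OF p F] by (rule bexE)
    then show "p \<in> X_set G A"
      unfolding X_set_def using coset_iff p(1) by (intro UN_I) auto
  qed
qed

text \<open>If no point of \<open>K\<close> were a limit, finitely many open sets, none of them
  eventually containing \<open>f\<close>, would cover \<open>K\<close>; but an ultrafilter must
  choose one set of a finite cover.\<close>

lemma ultrafilter_limitin_compactin:
  assumes p: "p \<in> ultrafilters_on S" and K: "compactin X K" and ev: "eventually (\<lambda>x. f x \<in> K) p"
  shows "\<exists>y. limitin X f y p"
proof (rule ccontr)
  assume no: "\<not> ?thesis"
  have "\<forall>y\<in>K. \<exists>U. openin X U \<and> y \<in> U \<and> \<not> eventually (\<lambda>x. f x \<in> U) p"
    using no compactin_subset_topspace[OF K] unfolding limitin_def by blast
  then obtain U where U: "\<And>y. y \<in> K \<Longrightarrow> openin X (U y) \<and> y \<in> U y \<and> \<not> eventually (\<lambda>x. f x \<in> U y) p"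
    by metis
  then have cov: "K \<subseteq> \<Union>(U ` K)" and op: "\<And>V. V \<in> U ` K \<Longrightarrow> openin X V" by auto
  from compactinD[OF K op cov] obtain \<F> where \<F>: "finite \<F>" "\<F> \<subseteq> U ` K" "K \<subseteq> \<Union>\<F>" by auto
  have "eventually (\<lambda>x. \<exists>V\<in>\<F>. f x \<in> V) p"
    using ev by (rule eventually_mono) (use \<F>(3) in blast)
  then obtain V where "V \<in> \<F>" "eventually (\<lambda>x. f x \<in> V) p"
    using ultrafilter_finite_UN[OF p \<F>(1), of "\<lambda>V x. f x \<in> V"] by blast
  then show False using \<F>(2) U by blast
qed

section \<open>Convergence of the orbit map along ultrafilters\<close>

locale minimal_type_witness = locally_compact_G_space G X \<phi>
  for G (structure) and X :: "'x topology" and \<phi> +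
  fixes x0 :: 'x and A
  assumes base_point: "x0 \<in> topspace X"
    and minimal: "minimal_G_space G X \<phi>"
    and subset_carrier: "A \<subseteq> carrier G"
    and type: "relatively_compact_family G X \<phi> x0 = translate_ideal G A"
begin

sublocale group G
  using group_hom group_hom.axioms(1) by blast

abbreviation converges :: "'x \<Rightarrow> 'a filter \<Rightarrow> bool" where
  "converges \<equiv> limitin X (\<lambda>g. \<phi> g x0)"

text \<open>The set T of the overview: the fibre over \<open>x0\<close> of the limit map from
  \<open>X_set G A\<close> to \<open>X\<close>.\<close>

definition fibre :: "'a filter set" where
  "fibre = {p \<in> ultrafilters_on (carrier G). converges x0 p}"

text \<open>If \<open>p\<close> contains a \<open>B\<close> whose orbit points have compact closure,
  compactness gives a limit. Conversely, a limit has an open neighbourhood \<open>U\<close> inside a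
  compact set, and the elements of \<open>G\<close> moving \<open>x0\<close> into \<open>U\<close>
  form a member of the ideal that belongs to \<open>p\<close>.\<close>

lemma X_set_eq: "X_set G A = {p \<in> ultrafilters_on (carrier G). \<exists>y. converges y p}"
proof (intro equalityI subsetI)
  fix p assume "p \<in> X_set G A"
  then obtain B where p: "p \<in> ultrafilters_on (carrier G)" and B: "eventually (\<lambda>x. x \<in> B) p"
    "B \<in> relatively_compact_family G X \<phi> x0"
    using in_X_set_iff[OF is_group subset_carrier] type by auto
  let ?K = "X closure_of ((\<lambda>b. \<phi> b x0) ` B)"
  have K: "compactin X ?K" and BG: "B \<subseteq> carrier G"
    using B(2) by (auto simp: relatively_compact_family_def)
  have sub: "(\<lambda>b. \<phi> b x0) ` B \<subseteq> ?K"
    using BG element_image base_point by (intro closure_of_subset) auto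
  have "eventually (\<lambda>x. \<phi> x x0 \<in> ?K) p"
    using B(1) by (rule eventually_mono) (use sub in blast)
  from ultrafilter_limitin_compactin[OF p K this] p show "p \<in> {p \<in> ultrafilters_on (carrier G). \<exists>y. converges y p}" by blast
next
  fix p assume "p \<in> {p \<in> ultrafilters_on (carrier G). \<exists>y. converges y p}"
  then obtain y where p: "p \<in> ultrafilters_on (carrier G)" and y: "converges y p" by blast
  then obtain U K where U: "openin X U" "compactin X K" "y \<in> U" "U \<subseteq> K"
    using locally_compact unfolding locally_compact_space_def limitin_def by meson
  let ?B = "{g \<in> carrier G. \<phi> g x0 \<in> U}"
  have "X closure_of ((\<lambda>b. \<phi> b x0) ` ?B) \<subseteq> K"
    using U(4) compactin_imp_closedin[OF Hausdorff U(2)] by (intro closure_of_minimal) auto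
  then have "compactin X (X closure_of ((\<lambda>b. \<phi> b x0) ` ?B))"
    by (rule closed_compactin[OF U(2) _ closedin_closure_of])
  then have "?B \<in> translate_ideal G A"
    unfolding type[symmetric] relatively_compact_family_def by simp
  moreover have "eventually (\<lambda>g. g \<in> ?B) p"
    using ultrafilters_onD(2)[OF p] y U by (simp add: limitin_def eventually_conj_iff)
  ultimately show "p \<in> X_set G A"
    unfolding in_X_set_iff[OF is_group subset_carrier] using p by blast
qed

lemma fibre_subset: "fibre \<subseteq> X_set G A"
  by (auto simp: fibre_def X_set_eq)

lemma fibre_ultrafilter: "q \<in> fibre \<Longrightarrow> q \<in> ultrafilters_on (carrier G)"
  by (simp add: fibre_def)

lemma X_set_ultrafilter: "p \<in> X_set G A \<Longrightarrow> p \<in> ultrafilters_on (carrier G)"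
  by (simp add: X_set_eq)

lemma topspace_X_space: "topspace (X_space G A) = X_set G A"
  using X_set_ultrafilter by (auto simp: X_space_def)

text \<open>The limit map is equivariant: continuity of \<open>\<phi> g\<close> carries convergence
  to \<open>y\<close> over to convergence of the translated points to
  \<open>\<phi> g y\<close>.\<close>

lemma eventually_translate:
  assumes p: "p \<in> ultrafilters_on (carrier G)" "converges y p" and g: "g \<in> carrier G"
    and U: "openin X U" "\<phi> g y \<in> U"
  shows "\<forall>\<^sub>F h in p. \<phi> (g \<otimes> h) x0 \<in> U"
proof -
  have "limitin X (\<phi> g \<circ> (\<lambda>h. \<phi> h x0)) (\<phi> g y) p"
    using continuous[OF g] p(2) by (rule continuous_map_limit)
  then have "\<forall>\<^sub>F h in p. \<phi> g (\<phi> h x0) \<in> U" using U by (simp add: limitin_def)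
  with ultrafilters_onD(2)[OF p(1)] show ?thesis
    by eventually_elim (use g base_point in \<open>simp add: composition_rule\<close>)
qed

text \<open>An iterated limit: for fixed \<open>g\<close> the points
  \<open>\<phi> (g \<otimes> h) x0\<close> tend to \<open>\<phi> g x0\<close> as \<open>h\<close>
  runs along \<open>q\<close>, and these tend to \<open>y\<close> along \<open>p\<close>. Thus right
  multiplication by \<open>q\<close> preserves the fibres of the limit map.\<close>

lemma converges_filter_mult:
  assumes p: "p \<in> ultrafilters_on (carrier G)" "converges y p" and q: "q \<in> fibre"
  shows "converges y (p \<star> q)"
  unfolding limitin_def
proof (intro conjI allI impI)
  show "y \<in> topspace X" using p(2) by (simp add: limitin_def)
  fix U assume U: "openin X U \<and> y \<in> U"
  then have "\<forall>\<^sub>F g in p. \<phi> g x0 \<in> U" using p(2) by (simp add: limitin_def)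
  with ultrafilters_onD(2)[OF p(1)] show "\<forall>\<^sub>F g in p \<star> q. \<phi> g x0 \<in> U"
    unfolding eventually_filter_mult
    by eventually_elim (use q U eventually_translate[of q x0] in \<open>simp add: fibre_def\<close>)
qed

lemma X_set_filter_mult:
  assumes "p \<in> X_set G A" and q: "q \<in> fibre"
  shows "p \<star> q \<in> X_set G A"
proof -
  obtain y where p: "p \<in> ultrafilters_on (carrier G)" "converges y p"
    using assms(1) unfolding X_set_eq by blast
  show ?thesis
    using converges_filter_mult[OF p q] filter_mult_ultrafilter[OF p(1) fibre_ultrafilter[OF q]]
    unfolding X_set_eq by blast
qed

lemma fibre_filter_mult: "p \<in> fibre \<Longrightarrow> q \<in> fibre \<Longrightarrow> p \<star> q \<in> fibre"
  using converges_filter_mult[of p x0 q] filter_mult_ultrafilter[of p q]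
  by (simp add: fibre_def)

lemma continuous_map_X_space:
  assumes "q \<in> fibre"
  shows "continuous_map (X_space G A) (X_space G A) (\<lambda>p. p \<star> q)"
  unfolding X_space_def
proof (rule continuous_map_into_subtopology)
  show "continuous_map (subtopology (Stone_Cech (carrier G)) (X_set G A)) (Stone_Cech (carrier G))
      (\<lambda>p. p \<star> q)"
    by (intro continuous_map_from_subtopology continuous_map_filter_mult fibre_ultrafilter assms)
qed (use X_set_filter_mult[OF _ assms] in auto)

section \<open>Minimal closed invariant sets and their intersection with the fibre\<close>

context
  fixes M
  assumes M: "minimal_closed_invariant G (X_space G A) (Stone_Cech_action G) M"
begin

lemma min_subset: "M \<subseteq> X_set G A"
  using M closedin_subset[of "X_space G A" M] topspace_X_space
  by (simp add: minimal_closed_invariant_def)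

lemma min_action: "g \<in> carrier G \<Longrightarrow> p \<in> M \<Longrightarrow> Stone_Cech_action G g p \<in> M"
  using M unfolding minimal_closed_invariant_def G_invariant_def by blast

lemma min_eq:
  "closedin (X_space G A) N \<Longrightarrow> G_invariant G (Stone_Cech_action G) N \<Longrightarrow> N \<noteq> {} \<Longrightarrow> N \<subseteq> M \<Longrightarrow> N = M"
  using M unfolding minimal_closed_invariant_def by blast

text \<open>\<open>M\<close> is closed only relative to \<open>X_set G A\<close>; compactness of
  \<beta>G can be used through the closed set \<open>C\<close>.\<close>

lemma min_closed:
  obtains C where "closedin (Stone_Cech (carrier G)) C" "M = X_set G A \<inter> C"
proof -
  have "closedin (subtopology (Stone_Cech (carrier G)) (X_set G A)) M"
    using M by (simp add: minimal_closed_invariant_def X_space_def)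
  then obtain C where "closedin (Stone_Cech (carrier G)) C" "M = C \<inter> X_set G A"
    unfolding closedin_subtopology by (elim exE conjE)
  then show thesis by (intro that) (simp_all add: Int_commute)
qed

text \<open>The orbit of \<open>q\<close> stays in \<open>M\<close>, hence in \<open>C\<close>, and
  so does its limit \<open>p \<star> q\<close>. That the limit does not leave
  \<open>X_set G A\<close> is due to \<open>q\<close> lying in the fibre.\<close>

lemma min_filter_mult:
  assumes p: "p \<in> X_set G A" and q: "q \<in> M \<inter> fibre"
  shows "p \<star> q \<in> M"
proof -
  obtain C where C: "closedin (Stone_Cech (carrier G)) C" "M = X_set G A \<inter> C"
    by (rule min_closed)
  have "Stone_Cech_action G g q \<in> C" if "g \<in> carrier G" for g
    using min_action[OF that, of q] q C(2) by blast
  then have "p \<star> q \<in> C"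
    using p q X_set_ultrafilter fibre_ultrafilter by (intro filter_mult_in_closed_set[OF C(1)]) blast+
  then show ?thesis using C(2) X_set_filter_mult p q by blast
qed

lemma closedin_min_fibre: "closedin (Stone_Cech (carrier G)) (M \<inter> fibre)"
  and min_fibre_nonempty: "M \<inter> fibre \<noteq> {}"
proof -
  obtain C where C: "closedin (Stone_Cech (carrier G)) C" "M = X_set G A \<inter> C"
    by (rule min_closed)
  \<comment> \<open>\<open>K V\<close> is the clopen set of ultrafilters containing the elements of
    \<open>G\<close> that move \<open>x0\<close> into \<open>V\<close>; the intersection of all
    \<open>K V\<close> over neighbourhoods \<open>V\<close> of \<open>x0\<close> is the
    fibre.\<close>
  define K where "K V = {p \<in> ultrafilters_on (carrier G). \<forall>\<^sub>F g in p. \<phi> g x0 \<in> V}" for V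
  define \<V> where "\<V> = {V. openin X V \<and> x0 \<in> V}"
  have top: "topspace X \<in> \<V>" using base_point by (simp add: \<V>_def)
  have closed: "closedin (Stone_Cech (carrier G)) (C \<inter> K V)" for V
  proof -
    have "K V = K_set G {g \<in> carrier G. \<phi> g x0 \<in> V}"
      using ultrafilters_onD(2)[of _ "carrier G"]
      by (auto simp: K_def K_set_eq[OF Collect_restrict] eventually_conj_iff)
    then have "closedin (Stone_Cech (carrier G)) (K V)"
      by (simp add: K_set_def)
    then show ?thesis by (rule closedin_Int[OF C(1)])
  qed
  have "p \<in> fibre \<longleftrightarrow> (\<forall>V\<in>\<V>. p \<in> K V)" for p
    using top base_point by (auto simp: K_def fibre_def limitin_def \<V>_def)
  \<comment> \<open>\<open>M\<close> may be replaced by \<open>C\<close> because the fibre already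
    lies in \<open>X_set G A\<close>.\<close>
  then have eq: "M \<inter> fibre = \<Inter>((\<lambda>V. C \<inter> K V) ` \<V>)"
    using fibre_subset top unfolding C(2) by blast
  show "closedin (Stone_Cech (carrier G)) (M \<inter> fibre)"
    unfolding eq using closed top by (intro closedin_Inter) auto
  have nonempty: "\<exists>p. p \<in> C \<inter> K V" if V: "V \<in> \<V>" for V
  proof -
    obtain m where m: "m \<in> M" using M unfolding minimal_closed_invariant_def by blast
    then obtain y where y: "m \<in> ultrafilters_on (carrier G)" "converges y m"
      using min_subset X_set_eq by blast
    then have "y \<in> topspace X" by (simp add: limitin_def)
    \<comment> \<open>Minimality of \<open>X\<close> enters here: the limit \<open>y\<close> of
      \<open>m\<close> can be moved into any neighbourhood of \<open>x0\<close>, and the same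
      \<open>g\<close> moves \<open>m\<close> into \<open>K V\<close> without leaving
      \<open>M\<close>.\<close>
    then have "x0 \<in> X closure_of orbit G \<phi> y"
      using minimal base_point by (simp add: minimal_G_space_def)
    then obtain g where g: "g \<in> carrier G" "\<phi> g y \<in> V"
      using V unfolding in_closure_of \<V>_def orbit_def by blast
    have "\<forall>\<^sub>F h in m. \<phi> (g \<otimes> h) x0 \<in> V"
      using eventually_translate[OF y g(1)] V g(2) by (simp add: \<V>_def)
    then have "\<forall>\<^sub>F h in Stone_Cech_action G g m. \<phi> h x0 \<in> V"
      using y(1) by (simp add: eventually_Stone_Cech_action)
    moreover have "Stone_Cech_action G g m \<in> C"
      using min_action[OF g(1) m] C(2) by blast
    ultimately show ?thesis
      using Stone_Cech_action_ultrafilter[OF g(1) y(1)] unfolding K_def by blast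
  qed
  \<comment> \<open>The sets \<open>K V\<close> shrink with \<open>V\<close>, so the finite
    intersection property reduces to nonemptiness of single members.\<close>
  have directed: "\<exists>V\<in>\<V>. C \<inter> K V \<subseteq> \<Inter>\<F>"
    if "finite \<F>" "\<F> \<subseteq> (\<lambda>V. C \<inter> K V) ` \<V>" for \<F>
    using that
  proof (induction \<F> rule: finite_induct)
    case empty
    then show ?case using top by auto
  next
    case (insert F \<F>)
    then obtain V W where V: "V \<in> \<V>" "C \<inter> K V \<subseteq> \<Inter>\<F>" and W: "W \<in> \<V>" "F = C \<inter> K W" by auto
    have "C \<inter> K (V \<inter> W) \<subseteq> \<Inter>(insert F \<F>)"
      using V(2) unfolding W(2) K_def by (auto simp: eventually_conj_iff)
    moreover have "V \<inter> W \<in> \<V>" using V(1) W(1) by (auto simp: \<V>_def)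
    ultimately show ?case by blast
  qed
  have fip: "\<Inter>\<F> \<noteq> {}" if "finite \<F>" "\<F> \<subseteq> (\<lambda>V. C \<inter> K V) ` \<V>" for \<F>
  proof -
    from directed[OF that] obtain V where V: "V \<in> \<V>" "C \<inter> K V \<subseteq> \<Inter>\<F>" by (rule bexE)
    obtain p where "p \<in> C \<inter> K V" using nonempty[OF V(1)] by (rule exE)
    then have "p \<in> \<Inter>\<F>" by (rule subsetD[OF V(2)])
    then show ?thesis by (metis empty_iff)
  qed
  show "M \<inter> fibre \<noteq> {}"
    unfolding eq
    using compact_Stone_Cech[of "carrier G", unfolded compact_space_fip, THEN spec,
        of "(\<lambda>V. C \<inter> K V) ` \<V>", THEN mp] closed fip by simp
qed

lemma idempotent_right_identity:
  assumes w: "w \<in> M \<inter> fibre" "w \<star> w = w" and p: "p \<in> M"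
  shows "p \<star> w = p"
proof -
  let ?E = "M \<inter> {p \<in> topspace (X_space G A). p \<star> w = p}"
  have "Hausdorff_space (X_space G A)"
    unfolding X_space_def using Hausdorff_Stone_Cech by (rule Hausdorff_space_subtopology)
  then have "closedin (X_space G A) {p \<in> topspace (X_space G A). p \<star> w = p}"
    using continuous_map_X_space w(1) by (intro closedin_continuous_maps_eq) auto
  then have "closedin (X_space G A) ?E"
    using M by (auto simp: minimal_closed_invariant_def)
  moreover have "Stone_Cech_action G g p \<in> ?E" if g: "g \<in> carrier G" and p: "p \<in> ?E" for g p
  proof -
    have "Stone_Cech_action G g p \<star> w = Stone_Cech_action G g (p \<star> w)"
      using g p w(1) min_subset X_set_ultrafilter fibre_ultrafilter
      by (intro Stone_Cech_action_filter_mult[symmetric]) auto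
    then show ?thesis using g p min_action min_subset topspace_X_space by auto
  qed
  then have "G_invariant G (Stone_Cech_action G) ?E" by (auto simp: G_invariant_def)
  \<comment> \<open>Idempotence says precisely that \<open>w\<close> is a fixed point, so
    \<open>?E\<close> is not empty.\<close>
  moreover have "w \<in> ?E" using w min_subset topspace_X_space by auto
  ultimately have "?E = M" by (intro min_eq) auto
  then show ?thesis using p by blast
qed

end

section \<open>Mutually inverse right multiplications between two minimal sets\<close>

lemma right_inverse_exists:
  assumes M: "minimal_closed_invariant G (X_space G A) (Stone_Cech_action G) M"
    and N: "minimal_closed_invariant G (X_space G A) (Stone_Cech_action G) N"
    and q: "q \<in> M \<inter> fibre"
  shows "\<exists>r \<in> N \<inter> fibre. \<forall>p\<in>M. p \<star> r \<star> q = p"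
proof -
  \<comment> \<open>All elements of \<open>?D\<close> have the form \<open>r \<star> q\<close> with
    \<open>r\<close> in \<open>N \<inter> fibre\<close>, so an idempotent of \<open>?D\<close>
    yields the required \<open>r\<close>.\<close>
  let ?D = "(\<lambda>p. p \<star> q) ` (N \<inter> fibre)"
  have qu: "q \<in> ultrafilters_on (carrier G)" using q fibre_ultrafilter by blast
  have D: "?D \<subseteq> M \<inter> fibre"
    using min_filter_mult[OF M] q fibre_subset fibre_filter_mult by blast
  then have Du: "?D \<subseteq> ultrafilters_on (carrier G)" using fibre_ultrafilter by blast
  have "compactin (Stone_Cech (carrier G)) ?D"
    by (rule image_compactin[OF closedin_compact_space[OF compact_Stone_Cech closedin_min_fibre[OF N]]
          continuous_map_filter_mult[OF qu]])
  then have D_closed: "closedin (Stone_Cech (carrier G)) ?D"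
    by (rule compactin_imp_closedin[OF Hausdorff_Stone_Cech])
  have D_nonempty: "?D \<noteq> {}" using min_fibre_nonempty[OF N] by blast
  \<comment> \<open>The product of \<open>x\<close> and \<open>b \<star> q\<close> is
    \<open>x \<star> b \<star> q\<close>, and \<open>x \<star> b\<close> stays in \<open>N\<close>
    because left factors from \<open>X_set G A\<close> do not lead out of \<open>N\<close>.\<close>
  have D_mult: "x \<star> y \<in> ?D" if xy: "x \<in> ?D" "y \<in> ?D" for x y
  proof -
    obtain b where b: "b \<in> N \<inter> fibre" "y = b \<star> q" using xy(2) by blast
    have x: "x \<in> fibre" using xy(1) D by blast
    then have "x \<star> y = x \<star> b \<star> q"
      using filter_mult_assoc b qu fibre_ultrafilter by simp
    moreover have "x \<star> b \<in> N \<inter> fibre"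
      using min_filter_mult[OF N] fibre_filter_mult fibre_subset x b(1) by blast
    ultimately show ?thesis by blast
  qed
  have D_assoc: "x \<star> y \<star> z = x \<star> (y \<star> z)" if "x \<in> ?D" "y \<in> ?D" "z \<in> ?D" for x y z
    using that Du by (intro filter_mult_assoc) blast+
  have D_cont: "continuous_map (Stone_Cech (carrier G)) (Stone_Cech (carrier G)) (\<lambda>p. p \<star> y)"
    if "y \<in> ?D" for y
    using that Du by (intro continuous_map_filter_mult) blast
  have "\<exists>w\<in>?D. w \<star> w = w"
    by (rule compact_right_topological_idempotent[OF compact_Stone_Cech Hausdorff_Stone_Cech
          D_closed D_nonempty D_mult D_assoc D_cont])
  then obtain r where r: "r \<in> N \<inter> fibre" and idem: "r \<star> q \<star> (r \<star> q) = r \<star> q" by blast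
  have "p \<star> r \<star> q = p" if p: "p \<in> M" for p
  proof -
    have "p \<star> r \<star> q = p \<star> (r \<star> q)"
      using p r qu min_subset[OF M] X_set_ultrafilter fibre_ultrafilter
      by (intro filter_mult_assoc) auto
    also have "\<dots> = p"
      using idempotent_right_identity[OF M _ idem p] D r by blast
    finally show ?thesis .
  qed
  then show ?thesis using r by blast
qed

lemma isomorphic_minimal_sets:
  assumes M: "minimal_closed_invariant G (X_space G A) (Stone_Cech_action G) M"
    and N: "minimal_closed_invariant G (X_space G A) (Stone_Cech_action G) N"
  shows "isomorphic_G_spaces G
           (subtopology (X_space G A) M) (Stone_Cech_action G)
           (subtopology (X_space G A) N) (Stone_Cech_action G)"
proof -
  obtain q where q: "q \<in> M \<inter> fibre" using min_fibre_nonempty[OF M] by blast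
  obtain r where r: "r \<in> N \<inter> fibre" "\<forall>p\<in>M. p \<star> r \<star> q = p"
    using right_inverse_exists[OF M N q] by blast
  obtain q' where q': "q' \<in> M \<inter> fibre" "\<forall>p\<in>N. p \<star> q' \<star> r = p"
    using right_inverse_exists[OF N M r(1)] by blast
  \<comment> \<open>Right multiplication by \<open>r\<close> has the left inverse given by
    \<open>q\<close> and the right inverse given by \<open>q'\<close>, so these agree on
    \<open>N\<close>: the identity for \<open>r\<close> and \<open>q\<close>, taken at
    \<open>p \<star> q'\<close>, gives \<open>p \<star> q = p \<star> q'\<close>.\<close>
  have inv: "p \<star> q \<star> r = p" if p: "p \<in> N" for p
  proof -
    have "p \<star> q' \<in> M" using min_filter_mult[OF M _ q'(1)] p min_subset[OF N] by blast
    then have "p \<star> q' \<star> r \<star> q = p \<star> q'" using r(2) by blast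
    then show ?thesis using q'(2) p by metis
  qed
  have cont: "continuous_map (subtopology (X_space G A) K) (subtopology (X_space G A) L) (\<lambda>p. p \<star> s)"
    if K: "K \<subseteq> X_set G A" and L: "minimal_closed_invariant G (X_space G A) (Stone_Cech_action G) L"
      and s: "s \<in> L \<inter> fibre" for K L s
  proof (rule continuous_map_into_subtopology)
    show "continuous_map (subtopology (X_space G A) K) (X_space G A) (\<lambda>p. p \<star> s)"
      using s by (intro continuous_map_from_subtopology continuous_map_X_space) blast
  qed (use K min_filter_mult[OF L _ s] in auto)
  have "homeomorphic_maps (subtopology (X_space G A) M) (subtopology (X_space G A) N)
          (\<lambda>p. p \<star> r) (\<lambda>p. p \<star> q)"
    unfolding homeomorphic_maps_def
    using cont[OF min_subset[OF M] N r(1)] cont[OF min_subset[OF N] M q] r(2) inv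
    by auto
  then have "homeomorphic_map (subtopology (X_space G A) M) (subtopology (X_space G A) N) (\<lambda>p. p \<star> r)"
    by (rule homeomorphic_maps_imp_map)
  moreover have "Stone_Cech_action G g p \<star> r = Stone_Cech_action G g (p \<star> r)"
    if "g \<in> carrier G" "p \<in> M" for g p
    using that r(1) min_subset[OF M] X_set_ultrafilter fibre_ultrafilter
    by (intro Stone_Cech_action_filter_mult[symmetric]) auto
  ultimately show ?thesis
    unfolding isomorphic_G_spaces_def by (intro exI[of _ "\<lambda>p. p \<star> r"]) auto
qed

end

theorem corollary6p8:
  fixes G :: "('g, 'm) monoid_scheme"
    and A :: "'g set"
    and M N :: "'g filter set"
  assumes "group G"
    and "minimal_type TYPE('x) G A"
    and "minimal_closed_invariant G (X_space G A) (Stone_Cech_action G) M"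
    and "minimal_closed_invariant G (X_space G A) (Stone_Cech_action G) N"
  shows "isomorphic_G_spaces G
           (subtopology (X_space G A) M) (Stone_Cech_action G)
           (subtopology (X_space G A) N) (Stone_Cech_action G)"
proof -
  obtain X :: "'x topology" and \<phi> x0 where A: "A \<subseteq> carrier G" "A \<noteq> {}"
    and X: "pointed_locally_compact_G_space G X \<phi> x0" "minimal_G_space G X \<phi>"
      "G_space_type G X \<phi> x0 = translate_class G A"
    using assms(2) unfolding minimal_type_def by blast
  \<comment> \<open>\<open>A\<close> lies in its own class, so equality of the classes turns into
    equality of the two ideals for \<open>A\<close> itself.\<close>
  have "A \<in> G_space_type G X \<phi> x0"
    using X(3) A covered_by_translates_refl[OF assms(1) A(1)] by (simp add: translate_class_def)
  then have type: "relatively_compact_family G X \<phi> x0 = translate_ideal G A"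
    by (simp add: G_space_type_def)
  interpret locally_compact_G_space G X \<phi>
    using X(1) by (simp add: pointed_locally_compact_G_space_def)
  interpret minimal_type_witness G X \<phi> x0 A
    by unfold_locales (use X(1,2) A(1) type in \<open>auto simp: pointed_locally_compact_G_space_def\<close>)
  show ?thesis using assms(3,4) by (rule isomorphic_minimal_sets)
qed

end
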